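(* Let $q$ be a prime power and let $k\ge 1$ and $n\ge k+1$ be integers. Then \[ \mathrm{La}_q^*(n,\{Y_k,Y'_k\})=\Sigma_q(n,k). \]
   Context: Subspaces of an $n$-dimensional vector space over $\mathbb{F}_q$ are ordered by inclusion. $Y_k$ is the poset with $k+2$ elements $x_1,\dots,x_k,y,z$ where $x_1< x_2<\dots< x_k< y$ and $x_k<z$, with $y,z$ incomparable; $Y'_k$ is the same poset with all relations reversed. A poset $P$ is an induced subposet of $Q$ if there is an injection $\phi:P\to Q$ with $x\le_P y\iff\phi(x)\le_Q\phi(y)$. $\mathrm{La}^*_q(n,\mathcal{P})$ is the maximum size of a family of subspaces of an $n$-dimensional vector space over $\mathbb{F}_q$ containing no member of $\mathcal{P}$ as an induced subposet. $\Sigma_q(n,k)$ is the sum of the $k$ largest $q$-binomial coefficients $\begin{bmatrix} n\\ i\end{bmatrix}_q$ ($0\le i\le n$), where $\begin{bmatrix} n\\ i\end{bmatrix}_q=\prod_{0\le j<i}\frac{q^{n-j}-1}{q^{i-j}-1}$. *)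

theory Defs
  imports Complex_Main "HOL-Library.Cardinality" "HOL-Number_Theory.Prime_Powers"
begin

text \<open>A finite poset is represented by its reflexive order relation, a set of pairs; its ground
  set is the \<^const>\<open>Field\<close> of that relation.\<close>

definition induced_subposet :: "'a rel \<Rightarrow> 'b rel \<Rightarrow> bool" where
  "induced_subposet P Q \<longleftrightarrow>
    (\<exists>\<phi>. inj_on \<phi> (Field P) \<and> \<phi> ` Field P \<subseteq> Field Q \<and>
      (\<forall>x\<in>Field P. \<forall>y\<in>Field P. (x, y) \<in> P \<longleftrightarrow> (\<phi> x, \<phi> y) \<in> Q))"

datatype Y_vertex = x_elt nat | y_elt | z_elt

definition Y_poset :: "nat \<Rightarrow> Y_vertex rel" where
  "Y_poset k =
     {(x_elt i, x_elt j) |i j. 1 \<le> i \<and> i \<le> j \<and> j \<le> k}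
     \<union> {(x_elt i, y_elt) |i. 1 \<le> i \<and> i \<le> k}
     \<union> {(x_elt i, z_elt) |i. 1 \<le> i \<and> i \<le> k}
     \<union> {(y_elt, y_elt), (z_elt, z_elt)}"

definition Y_dual_poset :: "nat \<Rightarrow> Y_vertex rel" where
  "Y_dual_poset k = (Y_poset k)\<inverse>"

lemma Field_Y_poset: "Field (Y_poset k) = x_elt ` {1..k} \<union> {y_elt, z_elt}"
  unfolding Y_poset_def Field_def by (auto simp: image_iff)

lemma Partial_order_Y_poset: "Partial_order (Y_poset k)"
  unfolding partial_order_on_def preorder_on_def Field_Y_poset
  by (auto simp: Y_poset_def refl_on_def trans_def antisym_def)

lemma card_Field_Y_poset: "card (Field (Y_poset k)) = k + 2"
proof -
  have "card (x_elt ` {1..k}) = k"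
    by (simp add: card_image inj_on_def)
  moreover have "x_elt ` {1..k} \<inter> {y_elt, z_elt} = {}"
    by auto
  ultimately show ?thesis
    by (simp add: Field_Y_poset card_Un_disjoint)
qed

text \<open>The vector space is the whole type \<open>'v\<close>, with scalar multiplication \<open>scale\<close>. For a
  finite-dimensional space over a finite field the set of cardinalities below is finite, and it
  contains 0 as long as no member of the family of forbidden posets is empty.\<close>

definition La_star ::
    "('f::field \<Rightarrow> 'v::ab_group_add \<Rightarrow> 'v) \<Rightarrow> 'a rel set \<Rightarrow> nat" where
  "La_star scale Ps =
     Max {card F |F. F \<subseteq> {W. module.subspace scale W} \<and>
                     (\<forall>P\<in>Ps. \<not> induced_subposet P (relation_of (\<subseteq>) F))}"

definition q_binomial :: "nat \<Rightarrow> nat \<Rightarrow> nat \<Rightarrow> real" where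
  "q_binomial q n i = (\<Prod>j<i. (real q ^ (n - j) - 1) / (real q ^ (i - j) - 1))"

definition Sigma_q :: "nat \<Rightarrow> nat \<Rightarrow> nat \<Rightarrow> real" where
  "Sigma_q q n k = sum_list (take k (rev (sort (map (q_binomial q n) [0..<n + 1]))))"

end

theory Submission
  imports Defs
begin

text \<open>
  For \<open>k \<ge> 2\<close> and a family \<open>F\<close> without the zero space and the whole space, one shows that
  a maximal flag meets \<open>F\<close> in at most \<open>k\<close> members on average, which gives the LYM inequality
  \<open>\<Sum>\<^sub>U 1 / [n, dim U]\<^sub>q \<le> k\<close>. Let \<open>U\<close> be the least member of \<open>F\<close> on a flag such that the members
  of \<open>F\<close> above \<open>U\<close> form a chain. Then the flag has at most \<open>k\<close> members of \<open>F\<close> up to \<open>U\<close>, and if the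
  part above \<open>U\<close> is varied, then on average at most \<open>1/3\<close> members above \<open>U\<close> are met. If there are
  exactly \<open>k\<close> members up to \<open>U\<close> and something lies above \<open>U\<close>, then the members of \<open>F\<close> below the
  second one, \<open>Z\<close>, form a chain, and the part of the flag below \<open>Z\<close> can be varied as well.
  If \<open>F\<close> contains the zero space, the other members contain no \<open>Y\<^bsub>k-1\<^esub>\<close>, and the first half of the
  argument bounds the average by \<open>k - 1 + 1/3\<close>; the slack pays for the two trivial subspaces.

  For \<open>k = 1\<close> the family is a union of pairwise incomparable chains. Its lowest level can be moved
  up, and its highest level down, until only the middle level remains (\<open>n\<close> even), or the two middle
  levels (\<open>n\<close> odd). In the latter case one averages over the intervals of rank 3: these are projective
  planes, where points \<open>P\<close> and lines \<open>Q\<close> whose incidences form a matching satisfy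
  \<open>|P| + |Q| \<le> q\<^sup>2 + q + 1\<close>.
\<close>

subsection \<open>Gaussian numbers and flags\<close>

text \<open>This is the q-integer \<open>(q^d - 1) / (q - 1)\<close>, the number of atoms of an
  interval of rank \<open>d\<close>; as a sum it stays in the naturals.\<close>

definition gnum :: "nat \<Rightarrow> nat \<Rightarrow> nat" where
  "gnum q d = (\<Sum>i<d. q ^ i)"

definition gfact :: "nat \<Rightarrow> nat \<Rightarrow> nat" where
  "gfact q d = (\<Prod>i<d. gnum q (Suc i))"

lemma gnum_0 [simp]: "gnum q 0 = 0"
  by (simp add: gnum_def)

lemma gnum_Suc: "gnum q (Suc d) = gnum q d + q ^ d"
  by (simp add: gnum_def)

lemma gnum_1 [simp]: "gnum q (Suc 0) = 1"
  by (simp add: gnum_def)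

lemma gnum_Suc_pos: "gnum q (Suc d) > 0"
  unfolding gnum_def by (subst sum.lessThan_Suc_shift) simp

lemma gnum_mono: "d \<le> e \<Longrightarrow> gnum q d \<le> gnum q e"
  unfolding gnum_def by (rule sum_mono2) auto

lemma gfact_0 [simp]: "gfact q 0 = 1"
  by (simp add: gfact_def)

lemma gfact_Suc: "gfact q (Suc d) = gfact q d * gnum q (Suc d)"
  by (simp add: gfact_def)

lemma gfact_1 [simp]: "gfact q (Suc 0) = 1"
  by (simp add: gfact_Suc gnum_Suc)

lemma gfact_pos [simp]: "gfact q d > 0"
  unfolding gfact_def using gnum_Suc_pos by simp

text \<open>In an interval of rank \<open>i + j + 2\<close>, a member of relative rank
  \<open>i + 1\<close> lies on as many flags as the left side says. Hence a member strictly inside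
  lies on at most a \<open>1 / gnum q (i + j + 2)\<close> share of all flags.\<close>

lemma gfact_mult_le: "gfact q (Suc i) * gfact q (Suc j) \<le> gfact q (Suc (i + j))"
proof (induction j)
  case (Suc j)
  have "gfact q (Suc i) * gfact q (Suc (Suc j)) = (gfact q (Suc i) * gfact q (Suc j)) * gnum q (Suc (Suc j))"
    by (simp add: gfact_Suc)
  also have "\<dots> \<le> gfact q (Suc (i + j)) * gnum q (Suc (Suc (i + j)))"
    using Suc gnum_mono[of "Suc (Suc j)" "Suc (Suc (i + j))" q] by (intro mult_mono) auto
  finally show ?case
    by (simp add: gfact_Suc)
qed simp

text \<open>Source of the constant \<open>1 / 3\<close>: a chain strictly inside an interval of rank
  \<open>d + 1\<close> has at most \<open>d\<close> members, each on at most a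
  \<open>1 / gnum q (d + 1)\<close> share of the flags. For \<open>q = 2\<close> and
  \<open>d = 1\<close> there is equality.\<close>

lemma le_gnum: "q \<ge> 2 \<Longrightarrow> 3 * d \<le> gnum q (Suc d)"
proof (induction d)
  case (Suc d)
  show ?case
  proof (cases "d = 0")
    case True
    then show ?thesis using Suc.prems by (simp add: gnum_Suc)
  next
    case False
    have "3 \<le> (2::nat) ^ 2" by simp
    also have "\<dots> \<le> q ^ 2" using Suc.prems by (intro power_mono) auto
    also have "q ^ 2 \<le> q ^ Suc d" using False Suc.prems by (intro power_increasing) auto
    finally show ?thesis using Suc by (simp add: gnum_Suc)
  qed
qed simp

lemma gnum_le_power:
  assumes "q \<ge> 2"
  shows "gnum q d \<le> q ^ d"
proof (induction d)
  case (Suc d)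
  have "gnum q (Suc d) \<le> 2 * q ^ d" using Suc by (simp add: gnum_Suc)
  also have "\<dots> \<le> q ^ Suc d" using assms by simp
  finally show ?case .
qed simp

lemma gnum_eq_div: "q \<ge> 2 \<Longrightarrow> real (gnum q d) = (real q ^ d - 1) / (real q - 1)"
  unfolding gnum_def by (simp add: geometric_sum)

text \<open>The factors \<open>q - 1\<close> cancel, the denominators in reverse order form a
  q-factorial, and the numerators telescope to a quotient of two.\<close>

lemma q_binomial_eq:
  assumes "q \<ge> 2" "i \<le> n"
  shows "q_binomial q n i = real (gfact q n) / (real (gfact q i) * real (gfact q (n - i)))"
proof -
  have "q_binomial q n i = (\<Prod>j<i. real (gnum q (n - j)) / real (gnum q (i - j)))"
    unfolding q_binomial_def using assms by (intro prod.cong) (auto simp: gnum_eq_div)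
  also have "\<dots> = (\<Prod>j<i. real (gnum q (n - j))) / (\<Prod>j<i. real (gnum q (i - j)))"
    by (rule prod_dividef)
  also have "(\<Prod>j<i. real (gnum q (i - j))) = real (gfact q i)"
  proof -
    have "(\<Prod>j<i. real (gnum q (Suc j))) = (\<Prod>j<i. real (gnum q (Suc (i - Suc j))))"
      by (rule prod.nat_diff_reindex[symmetric])
    also have "\<dots> = (\<Prod>j<i. real (gnum q (i - j)))"
      by (intro prod.cong) (auto simp: Suc_diff_Suc)
    finally show ?thesis by (simp add: gfact_def)
  qed
  also have "(\<Prod>j<i. real (gnum q (n - j))) = real (gfact q n) / real (gfact q (n - i))"
    using assms(2)
  proof (induction i)
    case (Suc i)
    have "gfact q (n - i) = gfact q (n - Suc i) * gnum q (n - i)"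
      using Suc.prems by (metis Suc_diff_Suc Suc_le_lessD gfact_Suc)
    moreover have "gnum q (n - i) > 0"
      using Suc.prems gnum_Suc_pos by (metis Suc_diff_Suc Suc_le_lessD)
    ultimately show ?case
      using Suc by (simp add: field_simps)
  qed (simp add: less_imp_neq[OF gfact_pos, symmetric])
  finally show ?thesis by (simp add: field_simps)
qed

lemma chain_subset_Un:
  assumes "chain\<^sub>\<subseteq> C1" "chain\<^sub>\<subseteq> C2" "\<And>U V. U \<in> C1 \<Longrightarrow> V \<in> C2 \<Longrightarrow> U \<subseteq> V"
  shows "chain\<^sub>\<subseteq> (C1 \<union> C2)"
  using assms unfolding chain_subset_def by blast

lemma chain_subset_mono: "chain\<^sub>\<subseteq> C \<Longrightarrow> D \<subseteq> C \<Longrightarrow> chain\<^sub>\<subseteq> D"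
  unfolding chain_subset_def by blast

text \<open>Stating everything for families of sets ordered by inclusion makes the dual lattice again
  such a family, via complements. The last axiom is all that is needed of meets and joins.\<close>

locale q_lattice =
  fixes L :: "'a set set" and rk :: "'a set \<Rightarrow> nat" and bot top :: "'a set" and q n :: nat
  assumes q2: "2 \<le> q"
    and finite_L: "finite L"
    and bot_in: "bot \<in> L" and top_in: "top \<in> L"
    and bot_le: "A \<in> L \<Longrightarrow> bot \<subseteq> A" and le_top: "A \<in> L \<Longrightarrow> A \<subseteq> top"
    and rk_bot: "rk bot = 0" and rk_top: "rk top = n"
    and rk_strict: "A \<in> L \<Longrightarrow> B \<in> L \<Longrightarrow> A \<subset> B \<Longrightarrow> rk A < rk B"
    and covers: "A \<in> L \<Longrightarrow> B \<in> L \<Longrightarrow> A \<subseteq> B \<Longrightarrow>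
      card {W \<in> L. A \<subseteq> W \<and> W \<subseteq> B \<and> rk W = Suc (rk A)} = gnum q (rk B - rk A)"
    and no_K22: "A \<in> L \<Longrightarrow> A' \<in> L \<Longrightarrow> W \<in> L \<Longrightarrow> W' \<in> L \<Longrightarrow> A \<noteq> A' \<Longrightarrow> rk A' = rk A \<Longrightarrow>
      rk W = Suc (rk A) \<Longrightarrow> rk W' = Suc (rk A) \<Longrightarrow>
      A \<subseteq> W \<Longrightarrow> A \<subseteq> W' \<Longrightarrow> A' \<subseteq> W \<Longrightarrow> A' \<subseteq> W' \<Longrightarrow> W = W'"
begin

section \<open>Maximal flags in an interval\<close>

definition lev :: "'a set \<Rightarrow> 'a set \<Rightarrow> nat \<Rightarrow> 'a set set" where
  "lev A B i = {W \<in> L. A \<subseteq> W \<and> W \<subseteq> B \<and> rk W = i}"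

text \<open>Flags are sets rather than lists. For \<open>A \<subseteq> B\<close> the prescribed size
  forces one member of every rank from \<open>rk A\<close> to \<open>rk B\<close>, so both ends are
  included.\<close>

definition flags :: "'a set \<Rightarrow> 'a set \<Rightarrow> 'a set set set" where
  "flags A B = {C. C \<subseteq> {W \<in> L. A \<subseteq> W \<and> W \<subseteq> B} \<and> chain\<^sub>\<subseteq> C \<and> card C = Suc (rk B - rk A)}"

lemma rk_mono: "A \<in> L \<Longrightarrow> B \<in> L \<Longrightarrow> A \<subseteq> B \<Longrightarrow> rk A \<le> rk B"
  using rk_strict[of A B] by (cases "A = B") (auto simp: psubset_eq)

lemma rk_eqD: "A \<in> L \<Longrightarrow> B \<in> L \<Longrightarrow> A \<subseteq> B \<Longrightarrow> rk B \<le> rk A \<Longrightarrow> A = B"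
  using rk_strict[of A B] by auto

lemma rk_le: "A \<in> L \<Longrightarrow> rk A \<le> n"
  using rk_mono[OF _ top_in le_top] rk_top by auto

lemma finite_lev [simp]: "finite (lev A B i)"
  unfolding lev_def using finite_L by simp

lemma finite_flags [simp]: "finite (flags A B)"
proof -
  have "flags A B \<subseteq> Pow L" unfolding flags_def by auto
  then show ?thesis using finite_L finite_subset by blast
qed

lemma chain_inj_rk:
  assumes "chain\<^sub>\<subseteq> C" "C \<subseteq> L"
  shows "inj_on rk C"
proof (rule inj_onI)
  fix U V assume *: "U \<in> C" "V \<in> C" "rk U = rk V"
  then have "U \<subseteq> V \<or> V \<subseteq> U" using assms unfolding chain_subset_def by blast
  then show "U = V"
    using * assms rk_eqD[of U V] rk_eqD[of V U] by auto
qed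

lemma flagsD:
  assumes "C \<in> flags A B"
  shows "C \<subseteq> L" "chain\<^sub>\<subseteq> C" "\<And>U. U \<in> C \<Longrightarrow> A \<subseteq> U \<and> U \<subseteq> B" "finite C" "card C = Suc (rk B - rk A)"
  using assms finite_L unfolding flags_def by (auto intro: finite_subset[of C L])

lemma flag_rk_image:
  assumes "C \<in> flags A B" "A \<in> L" "B \<in> L" "A \<subseteq> B"
  shows "rk ` C = {rk A..rk B}"
proof (rule card_subset_eq)
  note f = flagsD[OF assms(1)]
  show "rk ` C \<subseteq> {rk A..rk B}"
    using f rk_mono assms by auto
  show "card (rk ` C) = card {rk A..rk B}"
    using f chain_inj_rk rk_mono[OF assms(2-4)] by (simp add: card_image)
qed simp

lemma flag_ends:
  assumes "C \<in> flags A B" "A \<in> L" "B \<in> L" "A \<subseteq> B"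
  shows "A \<in> C" "B \<in> C"
proof -
  note f = flagsD[OF assms(1)] and i = flag_rk_image[OF assms] and r = rk_mono[OF assms(2-4)]
  obtain U where "U \<in> C" "rk U = rk A"
    using i r by (metis atLeastAtMost_iff imageE order_refl)
  then show "A \<in> C" using f rk_eqD[of A U] assms by auto
  obtain V where "V \<in> C" "rk V = rk B"
    using i r by (metis atLeastAtMost_iff imageE order_refl)
  then show "B \<in> C" using f rk_eqD[of V B] assms by auto
qed

lemma flag_Un:
  assumes "C1 \<in> flags A W" "C2 \<in> flags W B" "A \<in> L" "W \<in> L" "B \<in> L" "A \<subseteq> W" "W \<subseteq> B"
  shows "C1 \<union> C2 \<in> flags A B" "{U \<in> C1 \<union> C2. U \<subseteq> W} = C1" "{U \<in> C1 \<union> C2. W \<subseteq> U} = C2"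
    "C1 \<inter> C2 = {W}"
proof -
  note f1 = flagsD[OF assms(1)] and f2 = flagsD[OF assms(2)]
  have W: "W \<in> C1" "W \<in> C2" using flag_ends assms by blast+
  have le: "\<And>U. U \<in> C1 \<Longrightarrow> U \<subseteq> W" "\<And>U. U \<in> C2 \<Longrightarrow> W \<subseteq> U" using f1(3) f2(3) by simp_all
  have eq: "\<And>U. U \<in> C2 \<Longrightarrow> U \<subseteq> W \<Longrightarrow> U = W" "\<And>U. U \<in> C1 \<Longrightarrow> W \<subseteq> U \<Longrightarrow> U = W"
    using le by (simp_all add: subset_antisym)
  show i: "C1 \<inter> C2 = {W}"
  proof (intro equalityI subsetI)
    fix U assume "U \<in> C1 \<inter> C2"
    then show "U \<in> {W}" using le eq by simp
  qed (use W in simp)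
  have "U \<in> C1" if "U \<in> C2" "U \<subseteq> W" for U using eq(1)[OF that] W by simp
  then show "{U \<in> C1 \<union> C2. U \<subseteq> W} = C1"
    using le(1) unfolding set_eq_iff mem_Collect_eq Un_iff by metis
  have "U \<in> C2" if "U \<in> C1" "W \<subseteq> U" for U using eq(2)[OF that] W by simp
  then show "{U \<in> C1 \<union> C2. W \<subseteq> U} = C2"
    using le(2) unfolding set_eq_iff mem_Collect_eq Un_iff by metis
  have "rk A \<le> rk W" "rk W \<le> rk B" using rk_mono assms by auto
  then have "card (C1 \<union> C2) = Suc (rk B - rk A)"
    using card_Un_Int[OF f1(4) f2(4)] f1(5) f2(5) i by simp
  moreover have "chain\<^sub>\<subseteq> (C1 \<union> C2)"
    by (rule chain_subset_Un[OF f1(2) f2(2)]) (blast dest: le)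
  ultimately show "C1 \<union> C2 \<in> flags A B"
    using f1(1) f2(1) f1(3) f2(3) subset_trans[OF _ assms(7)] subset_trans[OF assms(6)]
    unfolding flags_def by (simp add: subset_eq[of _ "Collect _"] ball_Un subset_eq[of _ L])
qed

text \<open>Each half has at most as many members as there are ranks available to it. Only
  \<open>W\<close> is shared, so the sizes add up to exactly this maximum and both halves are
  full.\<close>

lemma flag_split:
  assumes "C \<in> flags A B" "W \<in> C" "A \<in> L" "B \<in> L"
  shows "{U \<in> C. U \<subseteq> W} \<in> flags A W" "{U \<in> C. W \<subseteq> U} \<in> flags W B"
    "{U \<in> C. U \<subseteq> W} \<union> {U \<in> C. W \<subseteq> U} = C"
proof -
  note f = flagsD[OF assms(1)]
  let ?C1 = "{U \<in> C. U \<subseteq> W}" and ?C2 = "{U \<in> C. W \<subseteq> U}"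
  have W: "W \<in> L" "A \<subseteq> W" "W \<subseteq> B" using f assms by auto
  have r: "rk A \<le> rk W" "rk W \<le> rk B" using rk_mono W assms by auto
  show u: "?C1 \<union> ?C2 = C" using f(2) assms(2) unfolding chain_subset_def by blast
  have i: "?C1 \<inter> ?C2 = {W}" using assms(2) by auto
  have ch: "chain\<^sub>\<subseteq> ?C1" "chain\<^sub>\<subseteq> ?C2"
    using f(2) unfolding chain_subset_def by auto
  have "rk ` ?C1 \<subseteq> {rk A..rk W}" "rk ` ?C2 \<subseteq> {rk W..rk B}"
    using f W assms rk_mono by auto
  then have "card (rk ` ?C1) \<le> card {rk A..rk W}" "card (rk ` ?C2) \<le> card {rk W..rk B}"
    by (simp_all only: card_mono finite_atLeastAtMost)
  moreover have "card (rk ` ?C1) = card ?C1" "card (rk ` ?C2) = card ?C2"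
    using chain_inj_rk ch f(1) by (auto intro!: card_image)
  moreover have "card ?C1 + card ?C2 = Suc (rk B - rk A) + 1"
    using card_Un_Int[of ?C1 ?C2] f(4,5) u i by simp
  ultimately have "card ?C1 = Suc (rk W - rk A)" "card ?C2 = Suc (rk B - rk W)"
    using r by simp_all
  then show "?C1 \<in> flags A W" "?C2 \<in> flags W B"
    using f W ch unfolding flags_def by auto
qed

text \<open>Cutting at \<open>W\<close> and taking unions are inverse to each other.
  \<open>R\<close> may be any condition that splits over the two parts; this is what allows one part
  of a flag to vary while the other is fixed.\<close>

lemma sum_flags_through:
  fixes h :: "'a set set \<Rightarrow> 'b :: comm_monoid_add"
  assumes "A \<in> L" "W \<in> L" "B \<in> L" "A \<subseteq> W" "W \<subseteq> B"
    and "\<And>C1 C2. C1 \<in> flags A W \<Longrightarrow> C2 \<in> flags W B \<Longrightarrow> R (C1 \<union> C2) \<longleftrightarrow> R1 C1 \<and> R2 C2"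
  shows "(\<Sum>C | C \<in> flags A B \<and> W \<in> C \<and> R C. h C)
    = (\<Sum>C1 | C1 \<in> flags A W \<and> R1 C1. \<Sum>C2 | C2 \<in> flags W B \<and> R2 C2. h (C1 \<union> C2))"
proof -
  have "(\<Sum>C | C \<in> flags A B \<and> W \<in> C \<and> R C. h C)
    = (\<Sum>(C1, C2) \<in> {C1. C1 \<in> flags A W \<and> R1 C1} \<times> {C2. C2 \<in> flags W B \<and> R2 C2}. h (C1 \<union> C2))"
  proof (rule sum.reindex_bij_witness[where i = "\<lambda>(C1, C2). C1 \<union> C2"
        and j = "\<lambda>C. ({U \<in> C. U \<subseteq> W}, {U \<in> C. W \<subseteq> U})"])
    fix C assume C: "C \<in> {C. C \<in> flags A B \<and> W \<in> C \<and> R C}"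
    then have C': "C \<in> flags A B" "W \<in> C" "R C" by auto
    note s = flag_split[OF C'(1,2) assms(1,3)]
    show "(case ({U \<in> C. U \<subseteq> W}, {U \<in> C. W \<subseteq> U}) of (C1, C2) \<Rightarrow> C1 \<union> C2) = C"
      using s by simp
    show "({U \<in> C. U \<subseteq> W}, {U \<in> C. W \<subseteq> U})
        \<in> {C1. C1 \<in> flags A W \<and> R1 C1} \<times> {C2. C2 \<in> flags W B \<and> R2 C2}"
      using s(1,2) assms(6)[OF s(1,2)] C'(3) by (simp add: s(3))
    show "(case ({U \<in> C. U \<subseteq> W}, {U \<in> C. W \<subseteq> U}) of (C1, C2) \<Rightarrow> h (C1 \<union> C2)) = h C"
      using s by simp
  next
    fix p assume "p \<in> {C1. C1 \<in> flags A W \<and> R1 C1} \<times> {C2. C2 \<in> flags W B \<and> R2 C2}"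
    then obtain C1 C2 where p: "p = (C1, C2)" "C1 \<in> flags A W" "C2 \<in> flags W B" "R1 C1" "R2 C2"
      by auto
    note s = flag_Un[OF p(2,3) assms(1-5)]
    show "({U \<in> case p of (C1, C2) \<Rightarrow> C1 \<union> C2. U \<subseteq> W}, {U \<in> case p of (C1, C2) \<Rightarrow> C1 \<union> C2. W \<subseteq> U}) = p"
      using s(2,3) p(1) by simp
    show "(case p of (C1, C2) \<Rightarrow> C1 \<union> C2) \<in> {C. C \<in> flags A B \<and> W \<in> C \<and> R C}"
      using s p assms(6)[OF p(2,3)] by auto
  qed
  then show ?thesis by (simp add: sum.cartesian_product)
qed

lemma card_flags_through:
  assumes "A \<in> L" "W \<in> L" "B \<in> L" "A \<subseteq> W" "W \<subseteq> B"
  shows "card {C \<in> flags A B. W \<in> C} = card (flags A W) * card (flags W B)"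
  using sum_flags_through[OF assms, of "\<lambda>_. True" "\<lambda>_. True" "\<lambda>_. True" "\<lambda>_. 1::nat"] by simp

text \<open>A flag has exactly one member of rank \<open>i\<close>, which sorts the flags into
  disjoint classes.\<close>

lemma sum_flags_by_level:
  fixes h :: "'a set set \<Rightarrow> 'b :: comm_monoid_add"
  assumes "A \<in> L" "B \<in> L" "A \<subseteq> B" "rk A \<le> i" "i \<le> rk B"
  shows "(\<Sum>C\<in>flags A B. h C) = (\<Sum>W\<in>lev A B i. \<Sum>C | C \<in> flags A B \<and> W \<in> C. h C)"
proof -
  have "flags A B = (\<Union>W\<in>lev A B i. {C. C \<in> flags A B \<and> W \<in> C})"
  proof (intro equalityI subsetI)
    fix C assume C: "C \<in> flags A B"
    then have "i \<in> rk ` C" using flag_rk_image assms by auto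
    then obtain W where W: "W \<in> C" "rk W = i" by auto
    then have "W \<in> lev A B i" using flagsD[OF C] by (auto simp: lev_def)
    then show "C \<in> (\<Union>W\<in>lev A B i. {C. C \<in> flags A B \<and> W \<in> C})" using W C by auto
  qed auto
  then have "(\<Sum>C\<in>flags A B. h C) = (\<Sum>C\<in>(\<Union>W\<in>lev A B i. {C. C \<in> flags A B \<and> W \<in> C}). h C)"
    by simp
  also have "\<dots> = (\<Sum>W\<in>lev A B i. \<Sum>C | C \<in> flags A B \<and> W \<in> C. h C)"
  proof (rule sum.UNION_disjoint)
    show "\<forall>W\<in>lev A B i. \<forall>W'\<in>lev A B i. W \<noteq> W' \<longrightarrow>
      {C. C \<in> flags A B \<and> W \<in> C} \<inter> {C. C \<in> flags A B \<and> W' \<in> C} = {}"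
    proof (intro ballI impI equals0I)
      fix W W' C assume "W \<in> lev A B i" "W' \<in> lev A B i" "W \<noteq> W'"
        "C \<in> {C. C \<in> flags A B \<and> W \<in> C} \<inter> {C. C \<in> flags A B \<and> W' \<in> C}"
      then show False
        using inj_onD[OF chain_inj_rk[OF flagsD(2,1)], of C A B A B W W'] by (simp add: lev_def)
    qed
  qed auto
  finally show ?thesis .
qed

lemma card_flags_by_level:
  assumes "A \<in> L" "B \<in> L" "A \<subseteq> B" "rk A \<le> i" "i \<le> rk B"
  shows "card (flags A B) = (\<Sum>W\<in>lev A B i. card (flags A W) * card (flags W B))"
proof -
  have "card (flags A B) = (\<Sum>W\<in>lev A B i. card {C \<in> flags A B. W \<in> C})"
    using sum_flags_by_level[OF assms, of "\<lambda>_. 1::nat"] by simp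
  also have "\<dots> = (\<Sum>W\<in>lev A B i. card (flags A W) * card (flags W B))"
    using assms by (intro sum.cong) (auto simp: lev_def intro!: card_flags_through)
  finally show ?thesis .
qed

lemma flags_short:
  assumes "A \<in> L" "B \<in> L" "A \<subseteq> B" "rk B \<le> Suc (rk A)"
  shows "flags A B = {{A, B}}"
proof -
  have r: "rk A \<le> rk B" using rk_mono assms by auto
  have c: "card {A, B} = Suc (rk B - rk A)"
  proof (cases "A = B")
    case False
    then have "rk B = Suc (rk A)" using assms(4) rk_eqD[OF assms(1-3)] by linarith
    then show ?thesis using False by simp
  qed simp
  have "{A, B} \<in> flags A B"
    using assms c unfolding flags_def chain_subset_def by (simp add: assms(3))
  moreover have "C = {A, B}" if C: "C \<in> flags A B" for C
  proof (rule card_seteq[symmetric])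
    show "{A, B} \<subseteq> C" using flag_ends[OF C assms(1-3)] by simp
    show "finite C" "card C \<le> card {A, B}" using flagsD(4,5)[OF C] c by simp_all
  qed
  ultimately show ?thesis unfolding set_eq_iff[of "flags A B"] by (metis singleton_iff)
qed

lemma card_flags:
  assumes "A \<in> L" "B \<in> L" "A \<subseteq> B"
  shows "card (flags A B) = gfact q (rk B - rk A)"
  using assms
proof (induction "rk B - rk A" arbitrary: A)
  case 0
  then show ?case by (simp add: flags_short)
next
  case (Suc d)
  have "card (flags A B) = (\<Sum>W\<in>lev A B (Suc (rk A)). card (flags A W) * card (flags W B))"
    using Suc by (intro card_flags_by_level) auto
  also have "\<dots> = (\<Sum>W\<in>lev A B (Suc (rk A)). gfact q d)"
  proof (rule sum.cong)
    fix W assume "W \<in> lev A B (Suc (rk A))"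
    then have W: "W \<in> L" "A \<subseteq> W" "W \<subseteq> B" "rk W = Suc (rk A)" by (auto simp: lev_def)
    then have "card (flags W B) = gfact q (rk B - rk W)" using Suc by (intro Suc(1)) auto
    then have "card (flags W B) = gfact q d" using Suc(2) W(4) by (metis Suc_inject diff_Suc_Suc Suc_diff_Suc zero_less_Suc zero_less_diff)
    moreover have "card (flags A W) = 1" using W Suc.prems by (simp add: flags_short)
    ultimately show "card (flags A W) * card (flags W B) = gfact q d" by simp
  qed simp
  also have "\<dots> = gnum q (Suc d) * gfact q d"
    using covers[OF Suc.prems] Suc(2) by (simp add: lev_def)
  finally show ?case using Suc(2) by (metis gfact_Suc mult.commute)
qed

text \<open>Flags are counted by their member of rank \<open>i\<close>. The product form of this
  q-binomial coefficient avoids division in the naturals.\<close>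

lemma card_lev:
  assumes "A \<in> L" "B \<in> L" "A \<subseteq> B" "rk A \<le> i" "i \<le> rk B"
  shows "card (lev A B i) * (gfact q (i - rk A) * gfact q (rk B - i)) = gfact q (rk B - rk A)"
proof -
  have "card (flags A B) = (\<Sum>W\<in>lev A B i. card (flags A W) * card (flags W B))"
    by (rule card_flags_by_level[OF assms])
  also have "\<dots> = (\<Sum>W\<in>lev A B i. gfact q (i - rk A) * gfact q (rk B - i))"
    using assms by (intro sum.cong) (auto simp: lev_def card_flags)
  finally show ?thesis using assms by (simp add: card_flags)
qed

text \<open>The axiom \<open>covers\<close> counts upward steps only; the number of downward steps,
  needed for \<open>covers\<close> in the dual, follows by comparing flag numbers.\<close>

lemma card_lev_coatoms:
  assumes "A \<in> L" "B \<in> L" "A \<subseteq> B" "rk B = Suc (rk A + d)"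
  shows "card (lev A B (rk A + d)) = gnum q (Suc d)"
proof -
  have "card (lev A B (rk A + d)) * gfact q d = gnum q (Suc d) * gfact q d"
    using card_lev[OF assms(1-3), of "rk A + d"] assms(4)
    by (simp add: gfact_Suc mult.commute del: mult_cancel1 mult_cancel2)
  then show ?thesis by (metis gfact_pos less_numeral_extra(3) mult_right_cancel)
qed

text \<open>Covers in the dual are coatoms of the original, counted by
  \<open>card_lev_coatoms\<close>, and \<open>no_K22\<close> is self-dual with the two pairs
  exchanging roles.\<close>

lemma dual: "q_lattice (uminus ` L) (\<lambda>W. n - rk (- W)) (- top) (- bot) q n"
proof
  show "2 \<le> q" "finite (uminus ` L)" "- top \<in> uminus ` L" "- bot \<in> uminus ` L"
    "n - rk (- (- top)) = 0" "n - rk (- (- bot)) = n"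
    using q2 finite_L bot_in top_in rk_bot rk_top by auto
  show "- top \<subseteq> A" "A \<subseteq> - bot" if "A \<in> uminus ` L" for A
    using that bot_le le_top by auto
next
  fix A B assume "A \<in> uminus ` L" "B \<in> uminus ` L" "A \<subset> B"
  then have *: "- A \<in> L" "- B \<in> L" "- B \<subset> - A" by auto
  then show "n - rk (- A) < n - rk (- B)"
    using rk_strict[OF *(2,1,3)] rk_le[OF *(1)] rk_le[OF *(2)] by linarith
next
  fix A B assume "A \<in> uminus ` L" "B \<in> uminus ` L" "A \<subseteq> B"
  then have *: "- A \<in> L" "- B \<in> L" "- B \<subseteq> - A" by auto
  note r = rk_le[OF *(1)] rk_le[OF *(2)] rk_mono[OF *(2,1,3)]
  have e: "{W \<in> uminus ` L. A \<subseteq> W \<and> W \<subseteq> B \<and> n - rk (- W) = Suc (n - rk (- A))}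
      = uminus ` {W \<in> L. - B \<subseteq> W \<and> W \<subseteq> - A \<and> Suc (rk W) = rk (- A)}" (is "?l = _ ` ?r")
  proof (intro equalityI subsetI)
    fix W assume "W \<in> ?l"
    then show "W \<in> uminus ` ?r"
      using r rk_le[of "- W"] by (auto intro!: image_eqI[of _ _ "- W"])
  next
    fix W assume "W \<in> uminus ` ?r"
    then show "W \<in> ?l" using r by auto
  qed
  have "card ?l = card ?r" unfolding e by (rule card_image) (simp add: inj_on_def)
  also have "\<dots> = gnum q (rk (- A) - rk (- B))"
  proof (cases "rk (- A) - rk (- B)")
    case 0
    then have "\<And>W. W \<in> L \<Longrightarrow> - B \<subseteq> W \<Longrightarrow> Suc (rk W) \<noteq> rk (- A)"
      using rk_mono[OF *(2)] by fastforce
    then have "?r = {}" by auto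
    then show ?thesis unfolding \<open>?r = {}\<close> using 0 by simp
  next
    case (Suc d)
    then have "?r = lev (- B) (- A) (rk (- B) + d)" using r by (auto simp: lev_def)
    then show ?thesis using card_lev_coatoms[OF *(2,1,3), of d] Suc r by simp
  qed
  also have "rk (- A) - rk (- B) = n - rk (- B) - (n - rk (- A))" using r by linarith
  finally show "card ?l = gnum q (n - rk (- B) - (n - rk (- A)))" .
next
  fix A A' W W'
  assume *: "A \<in> uminus ` L" "A' \<in> uminus ` L" "W \<in> uminus ` L" "W' \<in> uminus ` L" "A \<noteq> A'"
    "n - rk (- A') = n - rk (- A)" "n - rk (- W) = Suc (n - rk (- A))" "n - rk (- W') = Suc (n - rk (- A))"
    "A \<subseteq> W" "A \<subseteq> W'" "A' \<subseteq> W" "A' \<subseteq> W'"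
  then have l: "- A \<in> L" "- A' \<in> L" "- W \<in> L" "- W' \<in> L" by auto
  note r = rk_le[OF l(1)] rk_le[OF l(2)] rk_le[OF l(3)] rk_le[OF l(4)]
  show "W = W'"
  proof (rule ccontr)
    assume "W \<noteq> W'"
    then have "- A = - A'"
      using l * r by (intro no_K22[of "- W" "- W'" "- A" "- A'"]) auto
    then show False using *(5) by simp
  qed
qed

end

subsection \<open>The LYM inequality\<close>

definition upper_chain :: "'a set set \<Rightarrow> 'a set \<Rightarrow> bool" where
  "upper_chain F A \<longleftrightarrow> chain\<^sub>\<subseteq> {B \<in> F. A \<subset> B}"

definition lower_chain :: "'a set set \<Rightarrow> 'a set \<Rightarrow> bool" where
  "lower_chain F A \<longleftrightarrow> chain\<^sub>\<subseteq> {B \<in> F. B \<subset> A}"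

text \<open>\<open>S\<close> with greatest member \<open>A\<close> is a copy of
  \<open>x_1 < ... < x_k\<close>; two incomparable members of \<open>F\<close> above
  \<open>A\<close> would complete it to \<open>Y_k\<close>. The link to
  \<open>induced_subposet\<close> is \<open>induced_Y_poset\<close>.\<close>

definition Y_free :: "nat \<Rightarrow> 'a set set \<Rightarrow> bool" where
  "Y_free k F \<longleftrightarrow> (\<forall>S A. S \<subseteq> F \<longrightarrow> chain\<^sub>\<subseteq> S \<longrightarrow> card S = k \<longrightarrow> A \<in> S \<longrightarrow> (\<forall>V\<in>S. V \<subseteq> A) \<longrightarrow> upper_chain F A)"

definition Y_dual_free :: "nat \<Rightarrow> 'a set set \<Rightarrow> bool" where
  "Y_dual_free k F \<longleftrightarrow> (\<forall>S A. S \<subseteq> F \<longrightarrow> chain\<^sub>\<subseteq> S \<longrightarrow> card S = k \<longrightarrow> A \<in> S \<longrightarrow> (\<forall>V\<in>S. A \<subseteq> V) \<longrightarrow> lower_chain F A)"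

lemma finite_chain_max:
  assumes "finite S" "chain\<^sub>\<subseteq> S" "S \<noteq> {}"
  obtains M where "M \<in> S" "\<And>V. V \<in> S \<Longrightarrow> V \<subseteq> M"
proof -
  obtain M where "M \<in> S" "\<forall>V\<in>S. M \<subseteq> V \<longrightarrow> M = V"
    using finite_has_maximal[OF assms(1,3)] by auto
  then show ?thesis using that assms(2) unfolding chain_subset_def by metis
qed

text \<open>The number of members below serves as an index into the chain. Removing the greatest
  member changes this number for no other one, so induction applies.\<close>

lemma chain_kth_lowest:
  assumes "finite S" "chain\<^sub>\<subseteq> S" "1 \<le> k" "k \<le> card S"
  shows "\<exists>A\<in>S. card {V \<in> S. V \<subseteq> A} = k"
  using assms
proof (induction "card S" arbitrary: S)
  case (Suc m)
  then have "S \<noteq> {}" by auto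
  then obtain M where M: "M \<in> S" "\<And>V. V \<in> S \<Longrightarrow> V \<subseteq> M"
    using finite_chain_max Suc.prems by metis
  show ?case
  proof (cases "k = card S")
    case True
    moreover have "{V \<in> S. V \<subseteq> M} = S" using M by auto
    ultimately show ?thesis using M(1) by metis
  next
    case False
    have "\<exists>A\<in>S - {M}. card {V \<in> S - {M}. V \<subseteq> A} = k"
      using Suc False M(1) chain_subset_mono[OF Suc.prems(2)] by (intro Suc(1)) auto
    then obtain A where A: "A \<in> S" "A \<noteq> M" "card {V \<in> S - {M}. V \<subseteq> A} = k" by auto
    have "\<not> M \<subseteq> A" using A M by blast
    then have "{V \<in> S - {M}. V \<subseteq> A} = {V \<in> S. V \<subseteq> A}" by auto
    then show ?thesis using A by auto
  qed
qed simp

lemma chain_subset_uminus: "chain\<^sub>\<subseteq> (uminus ` S) \<longleftrightarrow> chain\<^sub>\<subseteq> S"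
  unfolding chain_subset_def by auto

lemma card_uminus_image: "card (uminus ` S) = card (S :: 'a set set)"
  by (rule card_image) (simp add: inj_on_def)

lemma chain_kth_highest:
  assumes "finite S" "chain\<^sub>\<subseteq> S" "1 \<le> k" "k \<le> card S"
  shows "\<exists>A\<in>S. card {V \<in> S. A \<subseteq> V} = k"
proof -
  have "\<exists>A\<in>uminus ` S. card {V \<in> uminus ` S. V \<subseteq> A} = k"
    using assms by (intro chain_kth_lowest) (auto simp: chain_subset_uminus card_uminus_image)
  then obtain A where A: "A \<in> S" "card {V \<in> uminus ` S. V \<subseteq> - A} = k" by auto
  moreover have "{V \<in> uminus ` S. V \<subseteq> - A} = uminus ` {V \<in> S. A \<subseteq> V}" by auto
  ultimately show ?thesis by (auto simp: card_uminus_image)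
qed

section \<open>Averages over flags\<close>

context q_lattice
begin

lemma sum_card_flags_Int:
  assumes "A \<in> L" "B \<in> L" "D \<subseteq> L" "\<And>U. U \<in> D \<Longrightarrow> A \<subseteq> U \<and> U \<subseteq> B"
  shows "(\<Sum>C\<in>flags A B. card (C \<inter> D)) = (\<Sum>U\<in>D. gfact q (rk U - rk A) * gfact q (rk B - rk U))"
proof -
  have fD: "finite D" using assms finite_L finite_subset by blast
  have "(\<Sum>C\<in>flags A B. card (C \<inter> D)) = (\<Sum>C\<in>flags A B. \<Sum>U\<in>D. if U \<in> C then 1 else 0)"
    using fD by (intro sum.cong) (auto simp: sum.If_cases Int_commute)
  also have "\<dots> = (\<Sum>U\<in>D. \<Sum>C\<in>flags A B. if U \<in> C then 1 else 0)"
    by (rule sum.swap)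
  also have "\<dots> = (\<Sum>U\<in>D. card {C \<in> flags A B. U \<in> C})"
    by (intro sum.cong) (auto simp: sum.If_cases intro!: arg_cong[of _ _ card])
  also have "\<dots> = (\<Sum>U\<in>D. gfact q (rk U - rk A) * gfact q (rk B - rk U))"
  proof (rule sum.cong)
    fix U assume "U \<in> D"
    then have "U \<in> L" "A \<subseteq> U" "U \<subseteq> B" using assms by auto
    then show "card {C \<in> flags A B. U \<in> C} = gfact q (rk U - rk A) * gfact q (rk B - rk U)"
      using card_flags_through[OF assms(1) _ assms(2)] card_flags assms(1,2) by simp
  qed simp
  finally show ?thesis .
qed

text \<open>In an interval of rank \<open>d + 2\<close>, the ranks of \<open>D\<close> are distinct
  and strictly inside, so \<open>card D\<close> is at most \<open>d + 1\<close>. Each member lies on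
  at most \<open>gfact q (d + 1)\<close> flags, and \<open>le_gnum\<close> bounds the product by a
  third of all flags.\<close>

lemma sum_card_chain_le:
  assumes "A \<in> L" "B \<in> L" "D \<subseteq> L" "chain\<^sub>\<subseteq> D" "\<And>U. U \<in> D \<Longrightarrow> A \<subset> U \<and> U \<subset> B"
  shows "3 * (\<Sum>C\<in>flags A B. card (C \<inter> D)) \<le> card (flags A B)"
proof (cases "D = {}")
  case False
  have lt: "rk A < rk U" "rk U < rk B" if "U \<in> D" for U
    using rk_strict assms that by auto
  then obtain d where d: "rk B = Suc (rk A + Suc d)"
  proof -
    obtain U where U: "U \<in> D" using False by blast
    obtain i j where "rk U = Suc (rk A + i)" "rk B = Suc (rk U + j)"
      using lt[OF U] less_imp_Suc_add by metis
    then show ?thesis using that[of "i + j"] by simp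
  qed
  have AB: "A \<subseteq> B" using assms(5) False by blast
  have "rk ` D \<subseteq> {rk A<..<rk B}" using lt by auto
  then have "card (rk ` D) \<le> card {rk A<..<rk B}" by (intro card_mono) simp_all
  then have cD: "card D \<le> Suc d"
    using card_image[OF chain_inj_rk[OF assms(4,3)]] d by simp
  have "(\<Sum>C\<in>flags A B. card (C \<inter> D)) = (\<Sum>U\<in>D. gfact q (rk U - rk A) * gfact q (rk B - rk U))"
    using assms by (intro sum_card_flags_Int) auto
  also have "\<dots> \<le> (\<Sum>U\<in>D. gfact q (Suc d))"
  proof (rule sum_mono)
    fix U assume "U \<in> D"
    then obtain i j where "rk U = Suc (rk A + i)" "rk B = Suc (rk U + j)"
      using lt less_imp_Suc_add by metis
    then have "rk U - rk A = Suc i" "rk B - rk U = Suc j" "d = i + j" using d by simp_all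
    then show "gfact q (rk U - rk A) * gfact q (rk B - rk U) \<le> gfact q (Suc d)"
      using gfact_mult_le[of q i j] by simp
  qed
  also have "\<dots> \<le> Suc d * gfact q (Suc d)" using mult_right_mono[OF cD] by simp
  finally have "3 * (\<Sum>C\<in>flags A B. card (C \<inter> D)) \<le> (3 * Suc d) * gfact q (Suc d)"
    unfolding mult.assoc by (rule mult_left_mono) simp
  also have "\<dots> \<le> gnum q (Suc (Suc d)) * gfact q (Suc d)"
    using le_gnum[OF q2, of "Suc d"] by (intro mult_right_mono) auto
  also have "\<dots> = card (flags A B)"
    using card_flags[OF assms(1,2) AB] d by (simp add: gfact_Suc mult.commute)
  finally show ?thesis .
qed simp

text \<open>At least two thirds of the flags avoid \<open>D'\<close>, and the average of \<open>|C \<inter> D|\<close> over all flags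
  is at most one third.\<close>

lemma sum_avoiding_flags_le:
  assumes "A \<in> L" "B \<in> L" "D \<subseteq> L" "chain\<^sub>\<subseteq> D" "\<And>U. U \<in> D \<Longrightarrow> A \<subset> U \<and> U \<subset> B" "D' \<subseteq> D"
  shows "(\<Sum>C | C \<in> flags A B \<and> C \<inter> D' = {}. real (card (C \<inter> D)) - 2 / 3) \<le> 0"
proof -
  let ?N = "card (flags A B)" and ?G = "{C. C \<in> flags A B \<and> C \<inter> D' = {}}"
  have fD: "finite D" using assms finite_L finite_subset by blast
  have 1: "3 * (\<Sum>C\<in>flags A B. card (C \<inter> D)) \<le> ?N"
    by (rule sum_card_chain_le[OF assms(1-5)])
  have 2: "3 * (\<Sum>C\<in>flags A B. card (C \<inter> D')) \<le> ?N"
    using assms chain_subset_mono[OF assms(4,6)] by (intro sum_card_chain_le) auto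
  \<comment> \<open>A flag outside \<open>?G\<close> meets \<open>D'\<close>, so it counts at least
    once in the sum for \<open>D'\<close>.\<close>
  have "card (flags A B - ?G) = (\<Sum>C\<in>flags A B - ?G. 1)" by simp
  also have "\<dots> \<le> (\<Sum>C\<in>flags A B - ?G. card (C \<inter> D'))"
    using finite_subset[OF assms(6) fD] by (intro sum_mono) (auto simp: Suc_le_eq card_gt_0_iff)
  also have "\<dots> \<le> (\<Sum>C\<in>flags A B. card (C \<inter> D'))" by (intro sum_mono2) auto
  finally have "3 * card (flags A B - ?G) \<le> ?N" using 2 by simp
  moreover have "card (flags A B - ?G) = ?N - card ?G" "card ?G \<le> ?N"
    by (auto intro: card_Diff_subset card_mono)
  ultimately have G: "2 * ?N \<le> 3 * card ?G" by simp
  have "(\<Sum>C\<in>?G. card (C \<inter> D)) \<le> (\<Sum>C\<in>flags A B. card (C \<inter> D))" by (intro sum_mono2) auto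
  then have S: "3 * (\<Sum>C\<in>?G. card (C \<inter> D)) \<le> ?N" using 1 by simp
  have "3 * (\<Sum>C\<in>?G. card (C \<inter> D)) \<le> 2 * card ?G" using G S by simp
  then have "3 * real (\<Sum>C\<in>?G. card (C \<inter> D)) \<le> 2 * real (card ?G)" by linarith
  then show ?thesis by (simp add: sum_subtractf)
qed

lemma flag_Int_finite [simp]: "C \<in> flags A B \<Longrightarrow> finite (C \<inter> F)"
  using flagsD(4) by blast

context
  fixes F :: "'a set set" and k :: nat
  assumes F: "F \<subseteq> L" "top \<notin> F" and k: "1 \<le> k" and Y: "Y_free k F"
begin

text \<open>The \<open>k\<close> lowest members of \<open>F\<close> on the flag form a chain to
  which \<open>Y_free\<close> applies. The count is kept in the conclusion to identify
  \<open>U\<close> as the \<open>k\<close>-th lowest.\<close>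

lemma flag_kth_upper_chain:
  assumes "C \<in> flags A B" "k \<le> card (C \<inter> F)"
  shows "\<exists>U\<in>C \<inter> F. upper_chain F U \<and> card {V \<in> C \<inter> F. V \<subseteq> U} = k"
proof -
  have ch: "chain\<^sub>\<subseteq> (C \<inter> F)" using chain_subset_mono[OF flagsD(2)[OF assms(1)]] by simp
  obtain U where U: "U \<in> C \<inter> F" "card {V \<in> C \<inter> F. V \<subseteq> U} = k"
    using chain_kth_lowest[OF flag_Int_finite[OF assms(1)] ch _ assms(2)] k by auto
  have chU: "chain\<^sub>\<subseteq> {V \<in> C \<inter> F. V \<subseteq> U}" by (rule chain_subset_mono[OF ch]) blast
  have "upper_chain F U"
  proof (rule Y[unfolded Y_free_def, rule_format, OF _ chU U(2)])
    show "{V \<in> C \<inter> F. V \<subseteq> U} \<subseteq> F" by blast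
    show "U \<in> {V \<in> C \<inter> F. V \<subseteq> U}" using U by simp
  qed (use U in auto)
  then show ?thesis using U by blast
qed

text \<open>For a flag \<open>C\<close> through \<open>U\<close>: no member of \<open>F\<close> on \<open>C\<close> below \<open>U\<close> qualifies as the least one above
  which \<open>F\<close> is a chain.\<close>

definition avoiding :: "'a set \<Rightarrow> 'a set set \<Rightarrow> bool" where
  "avoiding U C \<longleftrightarrow> (\<forall>V\<in>C. V \<subset> U \<longrightarrow> \<not> (V \<in> F \<and> upper_chain F V))"

text \<open>If there were more than \<open>k\<close> members, the \<open>k\<close>-th lowest would
  lie strictly below \<open>U\<close> and would have a chain above it, which \<open>avoiding\<close>
  excludes.\<close>

lemma card_avoiding_le:
  assumes "A \<in> L" "U \<in> F" "A \<subseteq> U" "C \<in> flags A U" "avoiding U C"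
  shows "card (C \<inter> F) \<le> k"
proof (rule ccontr)
  assume "\<not> card (C \<inter> F) \<le> k"
  then obtain V where V: "V \<in> C \<inter> F" "upper_chain F V" "card {W \<in> C \<inter> F. W \<subseteq> V} = k"
    and gt: "k < card (C \<inter> F)"
    using flag_kth_upper_chain[OF assms(4)] by auto
  have le: "W \<subseteq> U" if "W \<in> C" for W using flagsD(3)[OF assms(4) that] by simp
  have "V \<noteq> U"
  proof
    assume "V = U"
    then have "{W \<in> C \<inter> F. W \<subseteq> V} = C \<inter> F" using le by auto
    then show False using V gt by simp
  qed
  then have "V \<subset> U" using le V by auto
  then show False using assms(5) V unfolding avoiding_def by blast
qed

text \<open>A flag with fewer than \<open>k\<close> members contributes at most
  \<open>- 2 / 3\<close>. If there are exactly \<open>k\<close>, let \<open>Z\<close> be the second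
  lowest: the \<open>k - 1\<close> members from \<open>Z\<close> up and \<open>B\<close> form a
  chain of size \<open>k\<close>, so by \<open>Y_dual_free\<close> the members below
  \<open>Z\<close> form a chain, and the part below \<open>Z\<close> can be varied with
  \<open>sum_avoiding_flags_le\<close>.\<close>

lemma sum_lower_part_le:
  assumes bot: "bot \<notin> F" and k2: "2 \<le> k" and Y': "Y_dual_free k F"
    and U: "U \<in> F" and B: "B \<in> F" "U \<subset> B"
  shows "(\<Sum>C | C \<in> flags bot U \<and> avoiding U C. real (card (C \<inter> F)) - real k + 1 / 3) \<le> 0"
proof -
  let ?G = "{C. C \<in> flags bot U \<and> avoiding U C}"
  let ?f = "\<lambda>C. real (card (C \<inter> F)) - real k + 1 / 3"
  \<comment> \<open>\<open>Zs\<close> holds the candidates for \<open>Z\<close>. The condition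
    \<open>R Z\<close> counts from \<open>Z\<close> upwards only, so that \<open>GZ Z\<close> also
    contains the flags with no member below \<open>Z\<close>; the average over the lower part needs
    them.\<close>
  define Zs where "Zs = {Z \<in> F. Z \<subseteq> U \<and> lower_chain F Z}"
  define R where "R Z C \<longleftrightarrow> avoiding U C \<and> card {V \<in> C \<inter> F. Z \<subseteq> V} = k - 1" for Z C
  define GZ where "GZ Z = {C. C \<in> flags bot U \<and> Z \<in> C \<and> R Z C}" for Z
  have UL: "U \<in> L" using U F by auto
  have fin: "finite F" using F finite_L finite_subset by blast
  have neg: "?f C \<le> 0" if C: "C \<in> ?G - (\<Union>Z\<in>Zs. GZ Z)" for C
  proof -
    have C': "C \<in> flags bot U" "avoiding U C" using C by auto
    have "card (C \<inter> F) \<noteq> k"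
    proof
      assume ck: "card (C \<inter> F) = k"
      have ch: "chain\<^sub>\<subseteq> (C \<inter> F)" using chain_subset_mono[OF flagsD(2)[OF C'(1)]] by simp
      obtain Z where Z: "Z \<in> C \<inter> F" "card {V \<in> C \<inter> F. Z \<subseteq> V} = k - 1"
        using chain_kth_highest[OF flag_Int_finite[OF C'(1)] ch, of "k - 1"] ck k2 by force
      let ?S = "{V \<in> C \<inter> F. Z \<subseteq> V}"
      have le: "V \<subset> B" if "V \<in> C" for V using flagsD(3)[OF C'(1) that] B by auto
      have chS: "chain\<^sub>\<subseteq> (?S \<union> {B})"
      proof (rule chain_subset_Un[OF chain_subset_mono[OF ch]])
        show "V \<subseteq> W" if "V \<in> ?S" "W \<in> {B}" for V W using that le by auto
      qed (auto simp: chain_subset_def)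
      have cS: "card (?S \<union> {B}) = k"
      proof -
        have "B \<notin> ?S" "finite ?S" using le flagsD(4)[OF C'(1)] by auto
        then show ?thesis using Z(2) k by (simp del: mem_Collect_eq)
      qed
      have "lower_chain F Z"
      proof (rule Y'[unfolded Y_dual_free_def, rule_format, OF _ chS cS])
        show "?S \<union> {B} \<subseteq> F" "Z \<in> ?S \<union> {B}" using B Z(1) by auto
        show "Z \<subseteq> V" if "V \<in> ?S \<union> {B}" for V using that le[of Z] Z(1) by auto
      qed
      moreover have "Z \<subseteq> U" using flagsD(3)[OF C'(1)] Z(1) by simp
      ultimately have "Z \<in> Zs" "C \<in> GZ Z"
        using Z C' by (simp_all add: Zs_def GZ_def R_def)
      then show False using C by blast
    qed
    then have "card (C \<inter> F) < k"
      using card_avoiding_le[OF bot_in U bot_le[OF UL] C'] by simp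
    then show ?thesis by linarith
  qed
  have pos: "(\<Sum>C\<in>GZ Z. ?f C) \<le> 0" if "Z \<in> Zs" for Z
  proof -
    have Z: "Z \<in> L" "Z \<in> F" "Z \<subseteq> U" "lower_chain F Z" using that F by (auto simp: Zs_def)
    \<comment> \<open>\<open>?D'\<close> collects the members that \<open>avoiding\<close> forbids
      below \<open>Z\<close>.\<close>
    let ?D = "{V \<in> F. V \<subset> Z}" and ?D' = "{V \<in> F. V \<subset> Z \<and> upper_chain F V}"
    let ?R2 = "\<lambda>C. avoiding U C \<and> card (C \<inter> F) = k - 1"
    have "(\<Sum>C\<in>GZ Z. ?f C) = (\<Sum>C0 | C0 \<in> flags bot Z \<and> C0 \<inter> ?D' = {}.
        \<Sum>C1 | C1 \<in> flags Z U \<and> ?R2 C1. ?f (C0 \<union> C1))"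
      unfolding GZ_def
    proof (rule sum_flags_through[OF bot_in Z(1) UL bot_le[OF Z(1)] Z(3)])
      fix C0 C1 assume C: "C0 \<in> flags bot Z" "C1 \<in> flags Z U"
      note u = flag_Un[OF C bot_in Z(1) UL bot_le[OF Z(1)] Z(3)]
      have "{V \<in> (C0 \<union> C1) \<inter> F. Z \<subseteq> V} = {V \<in> C0 \<union> C1. Z \<subseteq> V} \<inter> F" by auto
      then have "{V \<in> (C0 \<union> C1) \<inter> F. Z \<subseteq> V} = C1 \<inter> F" using u(3) by simp
      moreover have "avoiding U (C0 \<union> C1) \<longleftrightarrow> C0 \<inter> ?D' = {} \<and> avoiding U C1"
      proof -
        \<comment> \<open>The shared element \<open>Z\<close> is treated as part of
          \<open>C1\<close>, since \<open>?D'\<close> lies strictly below \<open>Z\<close>.\<close>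
        have "V \<subset> U \<longleftrightarrow> V \<subset> Z \<or> (V \<in> C1 \<and> V \<subset> U)" if "V \<in> C0" for V
        proof -
          have "V \<subseteq> Z" using flagsD(3)[OF C(1) that] by simp
          moreover have "Z \<in> C1" using flag_ends[OF C(2) Z(1) UL Z(3)] by simp
          ultimately show ?thesis using Z(3) by (cases "V = Z") auto
        qed
        then show ?thesis unfolding avoiding_def by blast
      qed
      ultimately show "R Z (C0 \<union> C1) \<longleftrightarrow> C0 \<inter> ?D' = {} \<and> ?R2 C1"
        by (simp add: R_def)
    qed
    also have "\<dots> = (\<Sum>C0 | C0 \<in> flags bot Z \<and> C0 \<inter> ?D' = {}.
        \<Sum>C1 | C1 \<in> flags Z U \<and> ?R2 C1. real (card (C0 \<inter> ?D)) - 2 / 3)"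
    proof (intro sum.cong refl)
      fix C0 C1 assume C0: "C0 \<in> {C0. C0 \<in> flags bot Z \<and> C0 \<inter> ?D' = {}}"
        and C1: "C1 \<in> {C1. C1 \<in> flags Z U \<and> ?R2 C1}"
      then have C: "C0 \<in> flags bot Z" "C1 \<in> flags Z U" and c: "card (C1 \<inter> F) = k - 1" by auto
      have "(C0 \<union> C1) \<inter> F = (C0 \<inter> ?D) \<union> (C1 \<inter> F)"
        using flagsD(3)[OF C(1)] flag_ends[OF C(2) Z(1) UL Z(3)] by auto
      moreover have "(C0 \<inter> ?D) \<inter> (C1 \<inter> F) = {}"
        using flagsD(3)[OF C(2)] by auto
      ultimately have "card ((C0 \<union> C1) \<inter> F) = card (C0 \<inter> ?D) + (k - 1)"
        using C c by (simp add: card_Un_disjoint)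
      then show "?f (C0 \<union> C1) = real (card (C0 \<inter> ?D)) - 2 / 3"
        using k2 by (simp add: of_nat_diff)
    qed
    also have "\<dots> = real (card {C1. C1 \<in> flags Z U \<and> ?R2 C1}) *
        (\<Sum>C0 | C0 \<in> flags bot Z \<and> C0 \<inter> ?D' = {}. real (card (C0 \<inter> ?D)) - 2 / 3)"
      by (simp add: sum_distrib_left)
    also have "\<dots> \<le> 0"
    proof -
      have "(\<Sum>C0 | C0 \<in> flags bot Z \<and> C0 \<inter> ?D' = {}. real (card (C0 \<inter> ?D)) - 2 / 3) \<le> 0"
      proof (rule sum_avoiding_flags_le[OF bot_in Z(1)])
        show "?D \<subseteq> L" using F by auto
        show "chain\<^sub>\<subseteq> ?D" using Z(4) by (simp add: lower_chain_def)
        show "bot \<subset> V \<and> V \<subset> Z" if "V \<in> ?D" for V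
          using that F bot bot_le[of V] by auto
      qed auto
      then show ?thesis by (simp add: mult_nonneg_nonpos)
    qed
    finally show ?thesis .
  qed
  have sub: "(\<Union>Z\<in>Zs. GZ Z) \<subseteq> ?G" by (auto simp: GZ_def R_def)
  have "(\<Sum>C\<in>?G. ?f C) = (\<Sum>C\<in>?G - (\<Union>Z\<in>Zs. GZ Z). ?f C) + (\<Sum>C\<in>(\<Union>Z\<in>Zs. GZ Z). ?f C)"
    by (rule sum.subset_diff[OF sub]) simp
  also have "(\<Sum>C\<in>(\<Union>Z\<in>Zs. GZ Z). ?f C) = (\<Sum>Z\<in>Zs. \<Sum>C\<in>GZ Z. ?f C)"
  proof (rule sum.UNION_disjoint)
    show "finite Zs" using fin by (simp add: Zs_def)
    show "\<forall>Z\<in>Zs. finite (GZ Z)" by (simp add: GZ_def)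
    show "\<forall>Z\<in>Zs. \<forall>Z'\<in>Zs. Z \<noteq> Z' \<longrightarrow> GZ Z \<inter> GZ Z' = {}"
    proof (intro ballI impI equals0I)
      \<comment> \<open>The number of members from \<open>Z\<close> upwards drops strictly when
        \<open>Z\<close> moves up the flag, so a flag determines its \<open>Z\<close>.\<close>
      have key: False if "Z \<in> Zs" "Z' \<in> Zs" "Z \<subset> Z'" "C \<in> GZ Z" "C \<in> GZ Z'" for Z Z' C
      proof -
        have C: "C \<in> flags bot U" "Z \<in> C" "Z \<in> F" using that by (auto simp: GZ_def Zs_def)
        have "{V \<in> C \<inter> F. Z' \<subseteq> V} \<subset> {V \<in> C \<inter> F. Z \<subseteq> V}" using that C by blast
        then have "card {V \<in> C \<inter> F. Z' \<subseteq> V} < card {V \<in> C \<inter> F. Z \<subseteq> V}"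
          using flagsD(4)[OF C(1)] by (intro psubset_card_mono) simp_all
        then show False using that by (simp add: GZ_def R_def)
      qed
      fix Z Z' C assume "Z \<in> Zs" "Z' \<in> Zs" "Z \<noteq> Z'" "C \<in> GZ Z \<inter> GZ Z'"
      moreover from this have "Z \<subset> Z' \<or> Z' \<subset> Z"
        using flagsD(2)[of C bot U] by (simp add: GZ_def chain_subset_def psubset_eq)
      ultimately show False using key by blast
    qed
  qed
  also have "(\<Sum>C\<in>?G - (\<Union>Z\<in>Zs. GZ Z). ?f C) + (\<Sum>Z\<in>Zs. \<Sum>C\<in>GZ Z. ?f C) \<le> 0"
    using sum_nonpos[of "?G - (\<Union>Z\<in>Zs. GZ Z)" ?f] sum_nonpos[of Zs "\<lambda>Z. \<Sum>C\<in>GZ Z. ?f C"] neg pos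
    by (simp add: add_nonpos_nonpos)
  finally show ?thesis .
qed

text \<open>Above \<open>U\<close> the family is a chain strictly below \<open>top\<close>, so
  varying the upper part adds at most \<open>1 / 3\<close> on average. If some \<open>B\<close> lies
  above \<open>U\<close>, the assumption \<open>lower\<close> supplies this margin; otherwise
  nothing is added and \<open>card_avoiding_le\<close> suffices.\<close>

lemma sum_first_upper_chain_le:
  assumes e: "real k \<le> e"
    and lower: "\<And>B. B \<in> F \<Longrightarrow> U \<subset> B \<Longrightarrow>
      (\<Sum>C | C \<in> flags bot U \<and> avoiding U C. real (card (C \<inter> F)) - e + 1 / 3) \<le> 0"
    and U: "U \<in> F" "upper_chain F U"
  shows "(\<Sum>C | C \<in> flags bot top \<and> U \<in> C \<and> avoiding U C. real (card (C \<inter> F)) - e) \<le> 0"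
proof -
  have UL: "U \<in> L" using U F by auto
  let ?D = "{B \<in> F. U \<subset> B}" and ?N = "card (flags U top)"
  have D: "3 * (\<Sum>C\<in>flags U top. card (C \<inter> ?D)) \<le> ?N"
  proof (rule sum_card_chain_le[OF UL top_in])
    show "?D \<subseteq> L" using F by auto
    show "chain\<^sub>\<subseteq> ?D" using U by (simp add: upper_chain_def)
    show "U \<subset> B \<and> B \<subset> top" if "B \<in> ?D" for B
      using that F le_top[of B] by auto
  qed
  have "(\<Sum>C | C \<in> flags bot top \<and> U \<in> C \<and> avoiding U C. real (card (C \<inter> F)) - e)
    = (\<Sum>C1 | C1 \<in> flags bot U \<and> avoiding U C1. \<Sum>C2 | C2 \<in> flags U top \<and> True.
        real (card ((C1 \<union> C2) \<inter> F)) - e)"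
  proof (rule sum_flags_through[OF bot_in UL top_in bot_le[OF UL] le_top[OF UL]])
    fix C1 C2 assume C: "C1 \<in> flags bot U" "C2 \<in> flags U top"
    show "avoiding U (C1 \<union> C2) \<longleftrightarrow> avoiding U C1 \<and> True"
      using flagsD(3)[OF C(2)] unfolding avoiding_def by blast
  qed
  also have "\<dots> = (\<Sum>C1 | C1 \<in> flags bot U \<and> avoiding U C1. \<Sum>C2\<in>flags U top.
        (real (card (C1 \<inter> F)) - e) + real (card (C2 \<inter> ?D)))"
  proof (intro sum.cong)
    fix C1 C2 assume "C1 \<in> {C1. C1 \<in> flags bot U \<and> avoiding U C1}" "C2 \<in> flags U top"
    then have C: "C1 \<in> flags bot U" "C2 \<in> flags U top" by auto
    have "(C1 \<union> C2) \<inter> F = (C1 \<inter> F) \<union> (C2 \<inter> ?D)"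
      using flagsD(3)[OF C(2)] flag_ends[OF C(1) bot_in UL bot_le[OF UL]] by auto
    moreover have "(C1 \<inter> F) \<inter> (C2 \<inter> ?D) = {}"
      using flagsD(3)[OF C(1)] by auto
    ultimately show "real (card ((C1 \<union> C2) \<inter> F)) - e
        = (real (card (C1 \<inter> F)) - e) + real (card (C2 \<inter> ?D))"
      using C by (simp add: card_Un_disjoint)
  qed simp_all
  also have "\<dots> = (\<Sum>C1 | C1 \<in> flags bot U \<and> avoiding U C1.
      real ?N * (real (card (C1 \<inter> F)) - e) + real (\<Sum>C2\<in>flags U top. card (C2 \<inter> ?D)))"
    by (simp add: sum.distrib)
  also have "\<dots> \<le> 0"
  proof (cases "?D = {}")
    case True
    then show ?thesis
      unfolding True using card_avoiding_le[OF bot_in U(1) bot_le[OF UL]] e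
      by (intro sum_nonpos) (force simp: mult_nonneg_nonpos)
  next
    case False
    then obtain B where B: "B \<in> F" "U \<subset> B" by blast
    have "(\<Sum>C1 | C1 \<in> flags bot U \<and> avoiding U C1.
      real ?N * (real (card (C1 \<inter> F)) - e) + real (\<Sum>C2\<in>flags U top. card (C2 \<inter> ?D)))
      \<le> (\<Sum>C1 | C1 \<in> flags bot U \<and> avoiding U C1. real ?N * (real (card (C1 \<inter> F)) - e + 1 / 3))"
    proof (rule sum_mono)
      fix C1
      have "real (\<Sum>C2\<in>flags U top. card (C2 \<inter> ?D)) \<le> real ?N * (1 / 3)"
        using D by linarith
      then show "real ?N * (real (card (C1 \<inter> F)) - e) + real (\<Sum>C2\<in>flags U top. card (C2 \<inter> ?D))
          \<le> real ?N * (real (card (C1 \<inter> F)) - e + 1 / 3)"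
        by (simp add: distrib_left)
    qed
    also have "\<dots> = real ?N * (\<Sum>C1 | C1 \<in> flags bot U \<and> avoiding U C1. real (card (C1 \<inter> F)) - e + 1 / 3)"
      by (simp add: sum_distrib_left)
    also have "\<dots> \<le> 0"
      using lower[OF B] by (simp add: mult_nonneg_nonpos)
    finally show ?thesis .
  qed
  finally show ?thesis .
qed

text \<open>Flags are classified by their least member above which \<open>F\<close> is a chain. A
  flag without such a member has fewer than \<open>k\<close> members by
  \<open>flag_kth_upper_chain\<close>. The value \<open>e\<close> is \<open>k\<close> or
  \<open>k + 1 / 3\<close> in the applications.\<close>

lemma sum_card_flags_le:
  assumes e: "real k \<le> e"
    and lower: "\<And>U B. U \<in> F \<Longrightarrow> B \<in> F \<Longrightarrow> U \<subset> B \<Longrightarrow>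
      (\<Sum>C | C \<in> flags bot U \<and> avoiding U C. real (card (C \<inter> F)) - e + 1 / 3) \<le> 0"
  shows "(\<Sum>C\<in>flags bot top. real (card (C \<inter> F)) - e) \<le> 0"
proof -
  let ?f = "\<lambda>C. real (card (C \<inter> F)) - e"
  define Us where "Us = {U \<in> F. upper_chain F U}"
  define G where "G U = {C. C \<in> flags bot top \<and> U \<in> C \<and> avoiding U C}" for U
  have fin: "finite Us" unfolding Us_def using finite_subset[OF F(1) finite_L] by simp
  have sub: "(\<Union>U\<in>Us. G U) \<subseteq> flags bot top" by (auto simp: G_def)
  have neg: "?f C \<le> 0" if C: "C \<in> flags bot top - (\<Union>U\<in>Us. G U)" for C
  proof (rule ccontr)
    assume "\<not> ?f C \<le> 0"
    then have "k \<le> card (C \<inter> F)" using e by linarith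
    then have "\<exists>U\<in>C \<inter> F. upper_chain F U" using flag_kth_upper_chain[of C bot top] C by blast
    then have "C \<inter> Us \<noteq> {}" unfolding Us_def by blast
    moreover have "finite (C \<inter> Us)" using fin by simp
    ultimately obtain U where U: "U \<in> C \<inter> Us" "\<forall>V\<in>C \<inter> Us. V \<subseteq> U \<longrightarrow> U = V"
      using finite_has_minimal[of "C \<inter> Us"] by auto
    then have "C \<in> G U" using C by (auto simp: G_def avoiding_def Us_def)
    then show False using U C by auto
  qed
  have "(\<Sum>C\<in>flags bot top. ?f C) = (\<Sum>C\<in>flags bot top - (\<Union>U\<in>Us. G U). ?f C) + (\<Sum>C\<in>(\<Union>U\<in>Us. G U). ?f C)"
    by (rule sum.subset_diff[OF sub]) simp
  also have "(\<Sum>C\<in>(\<Union>U\<in>Us. G U). ?f C) = (\<Sum>U\<in>Us. \<Sum>C\<in>G U. ?f C)"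
  proof (rule sum.UNION_disjoint[OF fin])
    show "\<forall>U\<in>Us. finite (G U)" by (simp add: G_def)
    show "\<forall>U\<in>Us. \<forall>U'\<in>Us. U \<noteq> U' \<longrightarrow> G U \<inter> G U' = {}"
    proof (intro ballI impI equals0I)
      fix U U' C assume *: "U \<in> Us" "U' \<in> Us" "U \<noteq> U'" "C \<in> G U \<inter> G U'"
      then have "U \<subset> U' \<or> U' \<subset> U"
        using flagsD(2)[of C bot top] by (simp add: G_def chain_subset_def psubset_eq)
      then show False using * unfolding G_def avoiding_def Us_def by blast
    qed
  qed
  also have "(\<Sum>C\<in>flags bot top - (\<Union>U\<in>Us. G U). ?f C) + (\<Sum>U\<in>Us. \<Sum>C\<in>G U. ?f C) \<le> 0"
    using sum_nonpos[of "flags bot top - (\<Union>U\<in>Us. G U)" ?f] neg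
      sum_nonpos[of Us "\<lambda>U. \<Sum>C\<in>G U. ?f C"] sum_first_upper_chain_le[OF e lower]
    by (simp add: add_nonpos_nonpos G_def Us_def)
  finally show ?thesis .
qed

text \<open>The share of maximal flags passing through \<open>U\<close> is
  \<open>1 / q_binomial q n (rk U)\<close>.\<close>

lemma LYM_of_flags:
  assumes "(\<Sum>C\<in>flags bot top. real (card (C \<inter> F)) - e) \<le> 0"
  shows "(\<Sum>U\<in>F. 1 / q_binomial q n (rk U)) \<le> e"
proof -
  have "(\<Sum>C\<in>flags bot top. real (card (C \<inter> F))) \<le> e * real (card (flags bot top))"
    using assms by (simp add: sum_subtractf mult.commute)
  also have "card (flags bot top) = gfact q n"
    using card_flags[OF bot_in top_in bot_le[OF top_in]] rk_bot rk_top by simp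
  also have "(\<Sum>C\<in>flags bot top. real (card (C \<inter> F)))
      = real (\<Sum>U\<in>F. gfact q (rk U - rk bot) * gfact q (rk top - rk U))"
  proof -
    have "(\<Sum>C\<in>flags bot top. card (C \<inter> F)) = (\<Sum>U\<in>F. gfact q (rk U - rk bot) * gfact q (rk top - rk U))"
      by (rule sum_card_flags_Int[OF bot_in top_in F(1)]) (use F(1) bot_le le_top in blast)
    then show ?thesis by (simp flip: of_nat_sum)
  qed
  also have "\<dots> = (\<Sum>U\<in>F. real (gfact q n) * (1 / q_binomial q n (rk U)))"
    unfolding of_nat_sum
  proof (rule sum.cong)
    fix U assume "U \<in> F"
    then have "rk U \<le> n" using F(1) rk_le by auto
    then have "q_binomial q n (rk U) = real (gfact q n) / (real (gfact q (rk U)) * real (gfact q (n - rk U)))"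
      by (rule q_binomial_eq[OF q2])
    moreover have "real (gfact q n) > 0" by simp
    ultimately show "real (gfact q (rk U - rk bot) * gfact q (rk top - rk U))
        = real (gfact q n) * (1 / q_binomial q n (rk U))"
      unfolding rk_bot rk_top by simp
  qed simp
  also have "\<dots> = (\<Sum>U\<in>F. 1 / q_binomial q n (rk U)) * real (gfact q n)"
    by (simp only: sum_distrib_left[symmetric] mult.commute)
  finally show ?thesis by (rule mult_right_le_imp_le) simp
qed

text \<open>With \<open>e = k + 1 / 3\<close> the margin below \<open>U\<close> comes from
  \<open>card_avoiding_le\<close> alone. This form is applied with \<open>k - 1\<close> in
  \<open>upper_bound_bot\<close>.\<close>

lemma LYM_Y_free_weak: "(\<Sum>U\<in>F. 1 / q_binomial q n (rk U)) \<le> real k + 1 / 3"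
proof (rule LYM_of_flags[OF sum_card_flags_le])
  fix U B assume U: "U \<in> F"
  then have "U \<in> L" using F by auto
  then show "(\<Sum>C | C \<in> flags bot U \<and> avoiding U C. real (card (C \<inter> F)) - (real k + 1 / 3) + 1 / 3) \<le> 0"
    using card_avoiding_le[OF bot_in U bot_le] by (intro sum_nonpos) auto
qed simp

lemma LYM_Y_free:
  assumes "bot \<notin> F" "2 \<le> k" "Y_dual_free k F"
  shows "(\<Sum>U\<in>F. 1 / q_binomial q n (rk U)) \<le> real k"
  by (rule LYM_of_flags[OF sum_card_flags_le[OF order_refl sum_lower_part_le[OF assms]]])

end

end

subsection \<open>Unions of incomparable chains\<close>

lemma sum_card_swap:
  assumes "finite A" "finite B"
  shows "(\<Sum>x\<in>A. card {y \<in> B. R x y}) = (\<Sum>y\<in>B. card {x \<in> A. R x y})"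
proof -
  have "(\<Sum>x\<in>A. card {y \<in> B. R x y}) = (\<Sum>x\<in>A. \<Sum>y\<in>B. if R x y then 1 else 0)"
    using assms by (simp add: sum.If_cases Int_def)
  also have "\<dots> = (\<Sum>y\<in>B. \<Sum>x\<in>A. if R x y then 1 else 0)" by (rule sum.swap)
  also have "\<dots> = (\<Sum>y\<in>B. card {x \<in> A. R x y})"
    using assms by (simp add: sum.If_cases Int_def)
  finally show ?thesis .
qed

lemma card_le_1I: "(\<And>x y. x \<in> A \<Longrightarrow> y \<in> A \<Longrightarrow> x = y) \<Longrightarrow> card A \<le> 1"
  by (metis One_nat_def card.infinite card_le_Suc0_iff_eq zero_le_one)

text \<open>Cauchy-Schwarz against a constant, obtained from the nonnegative variance after scaling
  by \<open>card R\<close> to stay in the integers.\<close>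

lemma sum_power2_le:
  fixes f :: "'b \<Rightarrow> int"
  assumes "finite R"
  shows "(\<Sum>x\<in>R. f x)\<^sup>2 \<le> int (card R) * (\<Sum>x\<in>R. (f x)\<^sup>2)"
proof (cases "R = {}")
  case False
  let ?r = "int (card R)" and ?s = "\<Sum>x\<in>R. f x"
  have "0 \<le> (\<Sum>x\<in>R. (?r * f x - ?s)\<^sup>2)" by (simp add: sum_nonneg)
  also have "\<dots> = (\<Sum>x\<in>R. ?r\<^sup>2 * (f x)\<^sup>2 - 2 * ?r * ?s * f x + ?s\<^sup>2)"
    by (intro sum.cong) (auto simp: power2_eq_square algebra_simps)
  also have "\<dots> = ?r\<^sup>2 * (\<Sum>x\<in>R. (f x)\<^sup>2) - 2 * ?r * ?s * ?s + ?r * ?s\<^sup>2"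
    by (simp add: sum.distrib sum_subtractf flip: sum_distrib_left)
  also have "\<dots> = ?r * (?r * (\<Sum>x\<in>R. (f x)\<^sup>2) - ?s\<^sup>2)"
    by (simp add: power2_eq_square algebra_simps)
  finally show ?thesis
    using False assms by (simp add: zero_le_mult_iff card_gt_0_iff)
qed simp

text \<open>Count incidences of points with \<open>Q\<close>: outside \<open>P\<close> the degrees into \<open>Q\<close> have a large sum but a
  small sum of squares, so by Cauchy--Schwarz there are many points outside \<open>P\<close>.\<close>

lemma incidence_half_bound:
  fixes I :: "'a \<Rightarrow> 'b \<Rightarrow> bool"
  assumes q: "2 \<le> q" and fin: "finite X" "finite Y"
    and X: "card X = q\<^sup>2 + q + 1"
    and deg: "\<And>y. y \<in> Y \<Longrightarrow> card {x \<in> X. I x y} = q + 1"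
    and meet: "\<And>y y'. y \<in> Y \<Longrightarrow> y' \<in> Y \<Longrightarrow> y \<noteq> y' \<Longrightarrow> card {x \<in> X. I x y \<and> I x y'} \<le> 1"
    and PQ: "P \<subseteq> X" "Q \<subseteq> Y"
    and mP: "\<And>y. y \<in> Q \<Longrightarrow> card {x \<in> P. I x y} \<le> 1"
    and mQ: "\<And>x. x \<in> P \<Longrightarrow> card {y \<in> Q. I x y} \<le> 1"
    and half: "2 * card Q \<le> q\<^sup>2 + q + 2"
  shows "card P + card Q \<le> q\<^sup>2 + q + 1"
proof (rule ccontr)
  assume neg: "\<not> card P + card Q \<le> q\<^sup>2 + q + 1"
  have finP: "finite P" "finite Q" using fin PQ finite_subset by blast+
  define R where "R = X - P"
  define d where "d x = int (card {y \<in> Q. I x y})" for x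
  define l where "l = int (card Q)"
  define t where "t = (\<Sum>x\<in>P. d x)"
  define s where "s = (\<Sum>x\<in>R. d x)"
  have d1: "(\<Sum>x\<in>X. d x) = (int q + 1) * l"
  proof -
    have "(\<Sum>x\<in>X. card {y \<in> Q. I x y}) = (\<Sum>y\<in>Q. card {x \<in> X. I x y})"
      using fin finP by (intro sum_card_swap)
    also have "\<dots> = (\<Sum>y\<in>Q. q + 1)" using deg PQ by (intro sum.cong) auto
    finally show ?thesis unfolding d_def l_def by (simp add: algebra_simps flip: of_nat_sum)
  qed
  \<comment> \<open>Triples of a point and two lines of \<open>Q\<close> through it: equal lines
    give \<open>q + 1\<close> points, distinct lines at most one.\<close>
  have d2: "(\<Sum>x\<in>X. (d x)\<^sup>2) \<le> (int q + 1) * l + (l\<^sup>2 - l)"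
  proof -
    have sq: "(d x)\<^sup>2 = int (card {p \<in> Q \<times> Q. I x (fst p) \<and> I x (snd p)})" for x
    proof -
      have "{p \<in> Q \<times> Q. I x (fst p) \<and> I x (snd p)} = {y \<in> Q. I x y} \<times> {y \<in> Q. I x y}" by auto
      then show ?thesis by (simp add: d_def power2_eq_square card_cartesian_product)
    qed
    have "(\<Sum>x\<in>X. card {p \<in> Q \<times> Q. I x (fst p) \<and> I x (snd p)})
        = (\<Sum>p\<in>Q \<times> Q. card {x \<in> X. I x (fst p) \<and> I x (snd p)})"
      using fin finP by (intro sum_card_swap) auto
    also have "\<dots> = (\<Sum>y\<in>Q. \<Sum>y'\<in>Q. card {x \<in> X. I x y \<and> I x y'})"
      by (simp add: sum.cartesian_product case_prod_beta)
    also have "\<dots> \<le> (\<Sum>y\<in>Q. \<Sum>y'\<in>Q. 1 + (if y' = y then q else 0))"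
      using deg meet PQ by (intro sum_mono) (auto simp: subset_eq)
    also have "\<dots> = card Q * (card Q + q)" unfolding sum.distrib using finP by (simp add: algebra_simps)
    finally have "(\<Sum>x\<in>X. card {p \<in> Q \<times> Q. I x (fst p) \<and> I x (snd p)}) \<le> card Q * (card Q + q)" .
    then have "int (\<Sum>x\<in>X. card {p \<in> Q \<times> Q. I x (fst p) \<and> I x (snd p)}) \<le> int (card Q * (card Q + q))"
      by (simp only: of_nat_le_iff)
    then show ?thesis
      unfolding sq by (simp add: l_def power2_eq_square algebra_simps)
  qed
  have t: "t \<le> l"
  proof -
    have "(\<Sum>x\<in>P. card {y \<in> Q. I x y}) = (\<Sum>y\<in>Q. card {x \<in> P. I x y})"
      using finP by (intro sum_card_swap)
    also have "\<dots> \<le> (\<Sum>y\<in>Q. 1)" using mP by (intro sum_mono) auto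
    finally have "(\<Sum>x\<in>P. card {y \<in> Q. I x y}) \<le> card Q" by simp
    then show ?thesis unfolding t_def d_def l_def by (simp flip: of_nat_sum)
  qed
  \<comment> \<open>Degrees on \<open>P\<close> are 0 or 1, so they equal their squares.\<close>
  have t2: "(\<Sum>x\<in>P. (d x)\<^sup>2) = t"
    unfolding t_def
  proof (rule sum.cong)
    fix x assume "x \<in> P"
    then have "card {y \<in> Q. I x y} = 0 \<or> card {y \<in> Q. I x y} = 1" using mQ[of x] by linarith
    then show "(d x)\<^sup>2 = d x" unfolding d_def by auto
  qed simp
  have s: "s = (int q + 1) * l - t"
    using sum.subset_diff[OF PQ(1) fin(1), of d] d1 by (simp add: s_def t_def R_def)
  have s2: "(\<Sum>x\<in>R. (d x)\<^sup>2) \<le> s + l\<^sup>2 - l"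
    using sum.subset_diff[OF PQ(1) fin(1), of "\<lambda>x. (d x)\<^sup>2"] d2 t2 s by (simp add: R_def)
  have "card P \<le> card X" using PQ fin by (intro card_mono)
  moreover have "card R = card X - card P"
    using card_Diff_subset[OF finP(1) PQ(1)] by (simp add: R_def)
  ultimately have "card R < card Q" using neg X by linarith
  then have r: "int (card R) \<le> l - 1" by (simp add: l_def)
  \<comment> \<open>The negated claim says \<open>card R < card Q\<close>; with \<open>u\<close>
    this becomes \<open>card R \<le> u\<close>.\<close>
  define u where "u = l - 1"
  have u: "0 \<le> u" "l = u + 1" "int (card R) \<le> u" using r by (auto simp: u_def)
  have s_ge: "int q * (u + 1) \<le> s" using s t u by (simp add: algebra_simps)
  have "0 \<le> (\<Sum>x\<in>R. (d x)\<^sup>2)" by (simp add: sum_nonneg)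
  then have "s\<^sup>2 \<le> u * (s + l\<^sup>2 - l)"
    using sum_power2_le[of R d] fin s2 u mult_mono[OF u(3) s2] by (simp add: R_def s_def)
  then have 1: "s * (s - u) \<le> u\<^sup>2 * (u + 1)"
    unfolding u(2) by (simp add: power2_eq_square algebra_simps)
  have qu: "u \<le> int q * (u + 1)"
  proof -
    have "u \<le> 1 * (u + 1)" by simp
    also have "\<dots> \<le> int q * (u + 1)" using u(1) q by (intro mult_right_mono) auto
    finally show ?thesis .
  qed
  \<comment> \<open>Beyond \<open>u\<close> the product \<open>s * (s - u)\<close> grows with
    \<open>s\<close>, so the lower bound \<open>s_ge\<close> can be inserted and
    \<open>u + 1\<close> cancelled.\<close>
  have "(int q * (u + 1)) * (int q * (u + 1) - u) \<le> s * (s - u)"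
    using s_ge qu u(1) by (intro mult_mono) auto
  then have "(u + 1) * (int q * (int q * (u + 1) - u)) \<le> (u + 1) * u\<^sup>2"
    using 1 by (simp add: algebra_simps)
  then have 2: "int q * (int q * (u + 1) - u) \<le> u\<^sup>2"
    using u(1) by (simp add: mult_le_cancel_left)
  have h: "2 * u \<le> (int q)\<^sup>2 + int q"
  proof -
    have "int (2 * card Q) \<le> int (q\<^sup>2 + q + 2)" using half by (simp only: of_nat_le_iff)
    then show ?thesis using u(2) by (simp add: l_def)
  qed
  \<comment> \<open>Replacing one factor \<open>u\<close> by its bound from \<open>half\<close>
    turns inequality 2 into one linear in \<open>u\<close>.\<close>
  have "2 * u * u \<le> ((int q)\<^sup>2 + int q) * u" using h u(1) by (rule mult_right_mono)
  then have "int q * (2 * int q) \<le> int q * ((3 - int q) * u)"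
    using 2 by (simp add: power2_eq_square algebra_simps)
  then have 3: "2 * int q \<le> (3 - int q) * u"
    using q by (simp add: mult_le_cancel_left)
  show False
  \<comment> \<open>For \<open>q = 2\<close> inequality 3 gives \<open>u \<ge> 4\<close>, but
    \<open>h\<close> gives \<open>u \<le> 3\<close>. For larger \<open>q\<close> its right side is
    not positive.\<close>
  proof (cases "q = 2")
    case True
    then show ?thesis using 3 h by simp
  next
    case False
    then have "(3 - int q) * u \<le> 0" using q u(1) by (intro mult_nonpos_nonneg) auto
    then show ?thesis using 3 q by simp
  qed
qed

text \<open>If \<open>P\<close> or \<open>Q\<close> is small, \<open>incidence_half_bound\<close>
  applies to the plane or its dual. If both are large, it applies after \<open>Q\<close> is shrunk
  to half size, and then \<open>P\<close> turns out to be small.\<close>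

lemma incidence_bound:
  fixes I :: "'a \<Rightarrow> 'b \<Rightarrow> bool"
  assumes q: "2 \<le> q" and fin: "finite X" "finite Y"
    and card: "card X = q\<^sup>2 + q + 1" "card Y = q\<^sup>2 + q + 1"
    and deg: "\<And>y. y \<in> Y \<Longrightarrow> card {x \<in> X. I x y} = q + 1" "\<And>x. x \<in> X \<Longrightarrow> card {y \<in> Y. I x y} = q + 1"
    and meet: "\<And>x x' y y'. x \<in> X \<Longrightarrow> x' \<in> X \<Longrightarrow> y \<in> Y \<Longrightarrow> y' \<in> Y \<Longrightarrow>
      I x y \<Longrightarrow> I x y' \<Longrightarrow> I x' y \<Longrightarrow> I x' y' \<Longrightarrow> x = x' \<or> y = y'"
    and PQ: "P \<subseteq> X" "Q \<subseteq> Y"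
    and mP: "\<And>y. y \<in> Q \<Longrightarrow> card {x \<in> P. I x y} \<le> 1"
    and mQ: "\<And>x. x \<in> P \<Longrightarrow> card {y \<in> Q. I x y} \<le> 1"
  shows "card P + card Q \<le> q\<^sup>2 + q + 1"
proof -
  have meetY: "card {x \<in> X. I x y \<and> I x y'} \<le> 1" if "y \<in> Y" "y' \<in> Y" "y \<noteq> y'" for y y'
    using meet that by (intro card_le_1I) blast
  have meetX: "card {y \<in> Y. I x y \<and> I x' y} \<le> 1" if "x \<in> X" "x' \<in> X" "x \<noteq> x'" for x x'
    using meet that by (intro card_le_1I) blast
  have finQ: "finite Q" using fin PQ finite_subset by blast
  consider "2 * card Q \<le> q\<^sup>2 + q + 2" | "2 * card P \<le> q\<^sup>2 + q + 2"
    | "q\<^sup>2 + q + 2 < 2 * card Q" "q\<^sup>2 + q + 2 < 2 * card P" by linarith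
  then show ?thesis
  proof cases
    case 1
    show ?thesis
      by (rule incidence_half_bound[OF q fin card(1) deg(1) meetY PQ mP mQ 1])
  next
    case 2
    show ?thesis
      using incidence_half_bound[OF q fin(2,1) card(2), of "\<lambda>y x. I x y", OF deg(2) meetX PQ(2,1) mQ mP 2]
      by simp
  next
    case 3
    \<comment> \<open>Here \<open>2 * h - 1\<close> is the claimed bound: a set \<open>Q'\<close> of
      size \<open>h\<close> leaves at most \<open>h - 1\<close> points for \<open>P\<close>.\<close>
    have "even (q\<^sup>2 + q + 2)" by simp
    then obtain h where h: "q\<^sup>2 + q + 2 = 2 * h" by blast
    then obtain Q' where Q': "Q' \<subseteq> Q" "card Q' = h"
      using 3 obtain_subset_with_card_n[of h Q] by auto
    have "card P + card Q' \<le> q\<^sup>2 + q + 1"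
    proof (rule incidence_half_bound[OF q fin card(1) deg(1) meetY PQ(1)])
      show "card {y \<in> Q'. I x y} \<le> 1" if "x \<in> P" for x
      proof -
        have "card {y \<in> Q'. I x y} \<le> card {y \<in> Q. I x y}"
          using Q' finQ by (intro card_mono) auto
        then show ?thesis using mQ[OF that] by simp
      qed
    qed (use Q' PQ mP h in auto)
    then show ?thesis using 3 Q' h by linarith
  qed
qed

section \<open>Moving chain components to the middle levels\<close>

text \<open>This is what both exclusion conditions say for \<open>k = 1\<close>: \<open>F\<close> is
  a union of pairwise incomparable chains.\<close>

definition chain_comps :: "'a set set \<Rightarrow> bool" where
  "chain_comps F \<longleftrightarrow> (\<forall>A\<in>F. upper_chain F A \<and> lower_chain F A)"

lemma chain_comps_upperD:
  "chain_comps F \<Longrightarrow> A \<in> F \<Longrightarrow> B \<in> F \<Longrightarrow> C \<in> F \<Longrightarrow> A \<subset> B \<Longrightarrow> A \<subset> C \<Longrightarrow> B \<subseteq> C \<or> C \<subseteq> B"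
  unfolding chain_comps_def upper_chain_def chain_subset_def by auto

lemma chain_comps_lowerD:
  "chain_comps F \<Longrightarrow> A \<in> F \<Longrightarrow> B \<in> F \<Longrightarrow> C \<in> F \<Longrightarrow> B \<subset> A \<Longrightarrow> C \<subset> A \<Longrightarrow> B \<subseteq> C \<or> C \<subseteq> B"
  unfolding chain_comps_def lower_chain_def chain_subset_def by auto

lemma chain_compsI:
  assumes "\<And>A B C. A \<in> F \<Longrightarrow> B \<in> F \<Longrightarrow> C \<in> F \<Longrightarrow> A \<subset> B \<Longrightarrow> A \<subset> C \<Longrightarrow> B \<subseteq> C \<or> C \<subseteq> B"
    and "\<And>A B C. A \<in> F \<Longrightarrow> B \<in> F \<Longrightarrow> C \<in> F \<Longrightarrow> B \<subset> A \<Longrightarrow> C \<subset> A \<Longrightarrow> B \<subseteq> C \<or> C \<subseteq> B"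
  shows "chain_comps F"
  using assms unfolding chain_comps_def lower_chain_def upper_chain_def chain_subset_def by simp

lemma chain_comps_uminus: "chain_comps (uminus ` F) \<longleftrightarrow> chain_comps F"
proof -
  have "chain_comps (uminus ` F)" if F: "chain_comps F" for F :: "'a set set"
  proof (rule chain_compsI)
    fix A B C assume *: "A \<in> uminus ` F" "B \<in> uminus ` F" "C \<in> uminus ` F"
    then have i: "- A \<in> F" "- B \<in> F" "- C \<in> F" by auto
    show "B \<subseteq> C \<or> C \<subseteq> B" if "A \<subset> B" "A \<subset> C"
      using chain_comps_lowerD[OF F i] that by auto
    show "B \<subseteq> C \<or> C \<subseteq> B" if "B \<subset> A" "C \<subset> A"
      using chain_comps_upperD[OF F i] that by auto
  qed
  from this[of F] this[of "uminus ` F"] show ?thesis by (auto simp: image_image)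
qed

context q_lattice
begin

lemma lev_bot_top: "lev bot top i = {W \<in> L. rk W = i}"
  using bot_le le_top unfolding lev_def by metis

lemma card_lev_covers:
  assumes "A \<in> L" "B \<in> L" "A \<subseteq> B" "i = Suc (rk A)"
  shows "card (lev A B i) = gnum q (rk B - rk A)"
  using covers[OF assms(1-3)] assms(4) by (simp add: lev_def)

text \<open>The inner elements of a rank 3 interval are points and lines, and \<open>no_K22\<close>
  says that two points share at most one line. Distinct elements of equal rank are incomparable, so
  \<open>chain_comps\<close> leaves only a matching inside \<open>F\<close>.\<close>

lemma plane_bound:
  assumes F: "F \<subseteq> L" "chain_comps F" and XZ: "X \<in> L" "Z \<in> L" "X \<subseteq> Z" and r: "rk Z = rk X + 3"
  shows "card (F \<inter> lev X Z (rk X + 1)) + card (F \<inter> lev X Z (rk X + 2)) \<le> q\<^sup>2 + q + 1"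
proof (rule incidence_bound[where I = "(\<subseteq>)"])
  let ?P = "lev X Z (rk X + 1)" and ?Q = "lev X Z (rk X + 2)"
  have g: "gnum q 3 = q\<^sup>2 + q + 1" "gnum q 2 = q + 1"
    by (simp_all add: gnum_def eval_nat_numeral)
  show "card ?P = q\<^sup>2 + q + 1"
    using card_lev_covers[OF XZ, of "rk X + 1"] r g by simp
  show "card ?Q = q\<^sup>2 + q + 1"
    using card_lev_coatoms[OF XZ, of 2] r g by (simp add: eval_nat_numeral)
  show "card {x \<in> ?P. x \<subseteq> y} = q + 1" if y: "y \<in> ?Q" for y
  proof -
    have "{x \<in> ?P. x \<subseteq> y} = lev X y (rk X + 1)" using y by (auto simp: lev_def)
    then show ?thesis using card_lev_covers[of X y "rk X + 1"] XZ y g by (simp add: lev_def)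
  qed
  show "card {y \<in> ?Q. x \<subseteq> y} = q + 1" if x: "x \<in> ?P" for x
  proof -
    have "{y \<in> ?Q. x \<subseteq> y} = lev x Z (rk X + 2)" using x by (auto simp: lev_def)
    then show ?thesis using card_lev_covers[of x Z "rk X + 2"] XZ x g r by (simp add: lev_def)
  qed
  show "x = x' \<or> y = y'" if "x \<in> ?P" "x' \<in> ?P" "y \<in> ?Q" "y' \<in> ?Q" "x \<subseteq> y" "x \<subseteq> y'" "x' \<subseteq> y" "x' \<subseteq> y'"
    for x x' y y'
    using that no_K22[of x x' y y'] unfolding lev_def mem_Collect_eq add_2_eq_Suc' by auto
  show "card {x \<in> F \<inter> ?P. x \<subseteq> y} \<le> 1" if y: "y \<in> F \<inter> ?Q" for y
  proof (rule card_le_1I)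
    fix x x' assume "x \<in> {x \<in> F \<inter> ?P. x \<subseteq> y}" "x' \<in> {x \<in> F \<inter> ?P. x \<subseteq> y}"
    then have x: "x \<in> F" "x' \<in> F" "x \<subseteq> y" "x' \<subseteq> y" "x \<in> L" "x' \<in> L" "rk x = rk X + 1" "rk x' = rk X + 1"
      by (auto simp: lev_def)
    have "x \<noteq> y" "x' \<noteq> y" using x y by (auto simp: lev_def)
    then have "x \<subseteq> x' \<or> x' \<subseteq> x" using chain_comps_lowerD[OF F(2), of y x x'] x y by auto
    then show "x = x'" using x rk_eqD[of x x'] rk_eqD[of x' x] by auto
  qed
  show "card {y \<in> F \<inter> ?Q. x \<subseteq> y} \<le> 1" if y: "x \<in> F \<inter> ?P" for x
  proof (rule card_le_1I)
    fix y y' assume "y \<in> {y \<in> F \<inter> ?Q. x \<subseteq> y}" "y' \<in> {y \<in> F \<inter> ?Q. x \<subseteq> y}"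
    then have x: "y \<in> F" "y' \<in> F" "x \<subseteq> y" "x \<subseteq> y'" "y \<in> L" "y' \<in> L" "rk y = rk X + 2" "rk y' = rk X + 2"
      by (auto simp: lev_def)
    have "x \<noteq> y" "x \<noteq> y'" using x y by (auto simp: lev_def)
    then have "y \<subseteq> y' \<or> y' \<subseteq> y" using chain_comps_upperD[OF F(2), of x y y'] x y by auto
    then show "y = y'" using x rk_eqD[of y y'] rk_eqD[of y' y] by auto
  qed
qed (use q2 in auto)

text \<open>Averaging over the rank 3 intervals from rank \<open>m - 1\<close> to rank
  \<open>m + 2\<close>: each contains at most as many members of \<open>F\<close> as elements of
  rank \<open>m\<close>, so \<open>F\<close> is no larger than that level.\<close>

lemma two_level_bound:
  assumes F: "F \<subseteq> L" "chain_comps F" and n: "n = 2 * m + 1" "1 \<le> m"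
    and r: "\<And>A. A \<in> F \<Longrightarrow> rk A = m \<or> rk A = m + 1"
  shows "card F \<le> card (lev bot top m)"
proof -
  let ?M = "q\<^sup>2 + q + 1"
  obtain j where j: "m = Suc j" using n by (cases m) auto
  define T where "T = (SIGMA X : lev bot top j. lev X top (m + 2))"
  \<comment> \<open>The q-binomial coefficient of \<open>m + 1\<close> over 2; \<open>c_eq\<close>
    recovers it from the product form of \<open>card_lev\<close>.\<close>
  define c where "c = gfact q (m + 1) div (gfact q j * gfact q 2)"
  define K where "K = gnum q m * c"
  have c_eq: "a = c" if "a * (gfact q j * gfact q 2) = gfact q (m + 1)" for a
    using that unfolding c_def by (metis gfact_pos mult_pos_pos nonzero_mult_div_cancel_right less_numeral_extra(3))
  \<comment> \<open>The ranks \<open>j\<close> and \<open>m + 2\<close> lie symmetrically about the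
    two middle ranks, so elements of both levels lie in the same number \<open>K\<close> of
    intervals.\<close>
  have count: "(\<Sum>(X, Z)\<in>T. card (G \<inter> lev X Z i)) = card G * K"
    if G: "G \<subseteq> lev bot top i" and i: "i = m \<or> i = m + 1" for G i
  proof -
    have finG: "finite G" using G finite_lev finite_subset by blast
    have "(\<Sum>(X, Z)\<in>T. card (G \<inter> lev X Z i)) = (\<Sum>p\<in>T. card {A \<in> G. fst p \<subseteq> A \<and> A \<subseteq> snd p})"
      using G by (intro sum.cong) (auto simp: lev_def intro!: arg_cong[of _ _ card])
    also have "\<dots> = (\<Sum>A\<in>G. card {p \<in> T. fst p \<subseteq> A \<and> A \<subseteq> snd p})"
      using finG by (intro sum_card_swap) (auto simp: T_def)
    also have "\<dots> = (\<Sum>A\<in>G. K)"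
    proof (rule sum.cong)
      fix A assume "A \<in> G"
      then have A: "A \<in> L" "rk A = i" using G by (auto simp: lev_def)
      note le = bot_le[OF A(1)] le_top[OF A(1)]
      have "{p \<in> T. fst p \<subseteq> A \<and> A \<subseteq> snd p} = lev bot A j \<times> lev A top (m + 2)"
        using le bot_le le_top by (auto simp: T_def lev_def)
      then have "card {p \<in> T. fst p \<subseteq> A \<and> A \<subseteq> snd p} = card (lev bot A j) * card (lev A top (m + 2))"
        by (simp add: card_cartesian_product)
      also have "\<dots> = K"
      proof (cases "i = m")
        case True
        have "card (lev bot A j) = gnum q m"
          using card_lev_coatoms[OF bot_in A(1) le(1), of j] A True j rk_bot by simp
        moreover have "card (lev A top (m + 2)) * (gfact q 2 * gfact q j) = gfact q (m + 1)"
          using card_lev[OF A(1) top_in le(2), of "m + 2"] A True j n rk_top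
          by (simp add: Suc_diff_le numeral_2_eq_2)
        ultimately show ?thesis using c_eq by (simp add: K_def mult.commute)
      next
        case False
        then have im: "rk A = m + 1" using i A by simp
        have "card (lev A top (m + 2)) = gnum q m"
          using card_lev_covers[OF A(1) top_in le(2), of "m + 2"] im n rk_top by simp
        moreover have "card (lev bot A j) * (gfact q j * gfact q 2) = gfact q (m + 1)"
          using card_lev[OF bot_in A(1) le(1), of j] im j rk_bot
          by (simp add: Suc_diff_le numeral_2_eq_2)
        ultimately show ?thesis using c_eq by (simp add: K_def)
      qed
      finally show "card {p \<in> T. fst p \<subseteq> A \<and> A \<subseteq> snd p} = K" .
    qed simp
    finally show ?thesis by simp
  qed
  have T: "X \<in> L" "Z \<in> L" "X \<subseteq> Z" "rk X = j" "rk Z = rk X + 3" if "(X, Z) \<in> T" for X Z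
    using that j by (auto simp: T_def lev_def)
  let ?F0 = "F \<inter> lev bot top m" and ?F1 = "F \<inter> lev bot top (m + 1)"
  have finF: "finite F" using F finite_L finite_subset by blast
  have "F = ?F0 \<union> ?F1" using F r by (auto simp: lev_bot_top)
  moreover have "?F0 \<inter> ?F1 = {}" by (auto simp: lev_def)
  ultimately have "card F = card ?F0 + card ?F1"
    using finF by (metis card_Un_disjoint finite_Int)
  then have "card F * K = (\<Sum>(X, Z)\<in>T. card (?F0 \<inter> lev X Z m)) + (\<Sum>(X, Z)\<in>T. card (?F1 \<inter> lev X Z (m + 1)))"
    by (simp add: count algebra_simps)
  also have "\<dots> = (\<Sum>(X, Z)\<in>T. card (?F0 \<inter> lev X Z m) + card (?F1 \<inter> lev X Z (m + 1)))"
    by (simp add: sum.distrib case_prod_beta)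
  also have "\<dots> \<le> (\<Sum>(X, Z)\<in>T. card (lev bot top m \<inter> lev X Z m))"
  proof (rule sum_mono, clarify)
    fix X Z assume XZ: "(X, Z) \<in> T"
    note t = T[OF XZ]
    have sub: "lev X Z i \<subseteq> lev bot top i" for i using bot_le le_top by (auto simp: lev_def)
    have "card (?F0 \<inter> lev X Z m) + card (?F1 \<inter> lev X Z (m + 1)) \<le> ?M"
      using plane_bound[OF F t(1-3,5)] sub t(4) j
      by (simp add: Int_absorb1 Int_assoc[of F])
    also have "?M = card (lev X Z m)"
      using card_lev_covers[OF t(1-3), of m] t(4,5) j by (simp add: gnum_def eval_nat_numeral)
    also have "\<dots> = card (lev bot top m \<inter> lev X Z m)" using sub by (simp add: Int_absorb1)
    finally show "card (?F0 \<inter> lev X Z m) + card (?F1 \<inter> lev X Z (m + 1)) \<le> card (lev bot top m \<inter> lev X Z m)" .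
  qed
  also have "\<dots> = card (lev bot top m) * K" by (rule count) auto
  finally have "card F * K \<le> card (lev bot top m) * K" .
  moreover have "K > 0"
  proof -
    \<comment> \<open>Since \<open>c\<close> is defined by \<open>div\<close>, an actual element of
      rank \<open>m\<close> is used to see that the division is exact, hence
      \<open>c > 0\<close>.\<close>
    obtain X where "X \<in> L" "rk X = m"
    proof -
      have "card (lev bot top m) * (gfact q (m - rk bot) * gfact q (rk top - m)) = gfact q (rk top - rk bot)"
        using rk_bot rk_top n by (intro card_lev bot_in top_in bot_le) auto
      then have "card (lev bot top m) \<noteq> 0" by (metis gfact_pos less_numeral_extra(3) mult_eq_0_iff)
      then have "lev bot top m \<noteq> {}" by auto
      then show ?thesis using that by (auto simp: lev_def)
    qed
    then have "card (lev X top (m + 2)) * (gfact q j * gfact q 2) = gfact q (m + 1)"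
      using card_lev[OF _ top_in le_top, of X "m + 2"] j n rk_top
      by (simp add: Suc_diff_le numeral_2_eq_2 mult.commute)
    then have "c * (gfact q j * gfact q 2) = gfact q (m + 1)" using c_eq by metis
    then have "c > 0" by (metis gfact_pos gr0I mult_0 less_numeral_extra(3))
    then show ?thesis using gnum_Suc_pos[of q j] by (simp add: K_def j)
  qed
  ultimately show ?thesis by simp
qed

text \<open>The lowest level is replaced by those of its upper covers that lie below no other member;
  these are incomparable to everything that is kept.\<close>

lemma raise_lowest_level:
  assumes F: "F \<subseteq> L" "chain_comps F" and r: "\<And>A. A \<in> F \<Longrightarrow> a \<le> rk A \<and> rk A \<le> c"
    and c: "a < c" "c < n" and a: "2 * a + 2 \<le> n"
  shows "\<exists>F'\<subseteq>L. chain_comps F' \<and> (\<forall>A\<in>F'. a + 1 \<le> rk A \<and> rk A \<le> c) \<and> card F \<le> card F'"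
proof -
  define Fa where "Fa = {A \<in> F. rk A = a}"
  define F1 where "F1 = F - Fa"
  define S where "S = {B \<in> L. rk B = Suc a \<and> (\<exists>A\<in>Fa. A \<subseteq> B) \<and> (\<forall>D\<in>F1. \<not> B \<subseteq> D)}"
  have fin: "finite F" "finite Fa" "finite F1" "finite S"
    using finite_subset[OF F(1) finite_L] finite_L unfolding Fa_def F1_def S_def by simp_all
  have F1: "A \<in> F" "A \<in> L" "Suc a \<le> rk A" "rk A \<le> c" if "A \<in> F1" for A
    using that r[of A] F by (auto simp: F1_def Fa_def)
  have incomp: "\<not> B \<subset> D" "\<not> D \<subset> B" if "B \<in> S" "D \<in> F1 \<union> S" for B D
  proof -
    have B: "B \<in> L" "rk B = Suc a" using that by (auto simp: S_def)
    have D: "D \<in> L" "Suc a \<le> rk D" using that F1 by (auto simp: S_def)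
    show "\<not> D \<subset> B" using rk_strict[OF D(1) B(1)] B D by auto
    show "\<not> B \<subset> D"
    proof (cases "D \<in> F1")
      case True
      then show ?thesis using that(1) by (auto simp: S_def)
    next
      case False
      then show ?thesis using that rk_strict[OF B(1) D(1)] B by (auto simp: S_def)
    qed
  qed
  have cc: "chain_comps (F1 \<union> S)"
  proof (rule chain_compsI)
    fix A B C assume *: "A \<in> F1 \<union> S" "B \<in> F1 \<union> S" "C \<in> F1 \<union> S"
    show "B \<subseteq> C \<or> C \<subseteq> B" if "A \<subset> B" "A \<subset> C"
      using chain_comps_upperD[OF F(2), of A B C] F1(1) that incomp * by blast
    show "B \<subseteq> C \<or> C \<subseteq> B" if "B \<subset> A" "C \<subset> A"
      using chain_comps_lowerD[OF F(2), of A B C] F1(1) that incomp * by blast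
  qed
  have up: "q ^ (n - Suc a) \<le> card {B \<in> S. A \<subseteq> B}" if A: "A \<in> Fa" for A
  proof -
    have A': "A \<in> L" "A \<in> F" "rk A = a" using A F by (auto simp: Fa_def)
    let ?D = "{D \<in> F1. A \<subset> D}"
    \<comment> \<open>\<open>M\<close> is the greatest member above \<open>A\<close>, or
      \<open>A\<close> itself if there is none. A cover of \<open>A\<close> not below
      \<open>M\<close> lies below no kept member, so all but at most
      \<open>gnum q (n - Suc a)\<close> covers belong to \<open>S\<close>.\<close>
    have "\<exists>M\<in>L. A \<subseteq> M \<and> rk M < n \<and> (\<forall>D\<in>?D. D \<subseteq> M)"
    proof (cases "?D = {}")
      case True
      then have "A \<subseteq> A \<and> rk A < n \<and> (\<forall>D\<in>?D. D \<subseteq> A)" using A' c by auto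
      then show ?thesis using A'(1) by blast
    next
      case False
      have "chain\<^sub>\<subseteq> ?D"
        unfolding chain_subset_def
      proof (intro ballI)
        fix B C assume "B \<in> ?D" "C \<in> ?D"
        then show "B \<subseteq> C \<or> C \<subseteq> B"
          using chain_comps_upperD[OF F(2) A'(2), of B C] F1(1) by simp
      qed
      then obtain M where M: "M \<in> ?D" "\<And>D. D \<in> ?D \<Longrightarrow> D \<subseteq> M"
        using finite_chain_max[of ?D] False fin by auto
      then have "M \<in> L" "A \<subseteq> M" "rk M < n" using F1[of M] c by auto
      then show ?thesis using M(2) by blast
    qed
    then obtain M where M: "M \<in> L" "A \<subseteq> M" "rk M < n" "\<And>D. D \<in> ?D \<Longrightarrow> D \<subseteq> M" by blast
    have "lev A top (Suc a) - lev A M (Suc a) \<subseteq> {B \<in> S. A \<subseteq> B}"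
    proof
      fix B assume "B \<in> lev A top (Suc a) - lev A M (Suc a)"
      then have B: "B \<in> L" "A \<subseteq> B" "rk B = Suc a" "\<not> B \<subseteq> M" by (auto simp: lev_def)
      have "\<not> B \<subseteq> D" if D: "D \<in> F1" for D
      proof
        assume BD: "B \<subseteq> D"
        have "A \<noteq> D" using F1[OF D] A' by auto
        then have "D \<in> ?D" using D BD B(2) by auto
        then show False using M(4)[of D] BD B(4) by auto
      qed
      then show "B \<in> {B \<in> S. A \<subseteq> B}" using B A by (auto simp: S_def)
    qed
    then have "card (lev A top (Suc a) - lev A M (Suc a)) \<le> card {B \<in> S. A \<subseteq> B}"
      using fin by (intro card_mono) auto
    moreover have "card (lev A top (Suc a)) - card (lev A M (Suc a)) \<le> card (lev A top (Suc a) - lev A M (Suc a))"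
      by (rule diff_card_le_card_Diff) simp
    moreover have "card (lev A top (Suc a)) = gnum q (n - a)"
      using card_lev_covers[OF A'(1) top_in le_top[OF A'(1)]] A' rk_top by simp
    moreover have "card (lev A M (Suc a)) \<le> gnum q (n - Suc a)"
      using card_lev_covers[OF A'(1) M(1,2)] A' M(3) gnum_mono[of "rk M - a" "n - Suc a" q] by simp
    moreover have "gnum q (n - a) = gnum q (n - Suc a) + q ^ (n - Suc a)"
      using a gnum_Suc[of q "n - Suc a"] by (simp add: Suc_diff_Suc)
    ultimately show ?thesis by linarith
  qed
  \<comment> \<open>An element of rank \<open>a + 1\<close> has \<open>gnum q (a + 1)\<close>
    coatoms, and \<open>2 * a + 2 \<le> n\<close> makes this at most the lower bound of
    \<open>up\<close>. Counting inclusions between \<open>Fa\<close> and \<open>S\<close> then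
    compares their sizes.\<close>
  have down: "card {A \<in> Fa. A \<subseteq> B} \<le> q ^ (n - Suc a)" if B: "B \<in> S" for B
  proof -
    have B': "B \<in> L" "rk B = Suc a" using B by (auto simp: S_def)
    have "{A \<in> Fa. A \<subseteq> B} \<subseteq> lev bot B a" using F bot_le by (auto simp: Fa_def lev_def)
    then have "card {A \<in> Fa. A \<subseteq> B} \<le> card (lev bot B a)" by (intro card_mono) auto
    also have "\<dots> = gnum q (Suc a)"
      using card_lev_coatoms[OF bot_in B'(1) bot_le[OF B'(1)], of a] B' rk_bot by simp
    also have "\<dots> \<le> q ^ Suc a" by (rule gnum_le_power[OF q2])
    also have "\<dots> \<le> q ^ (n - Suc a)" using a q2 by (intro power_increasing) auto
    finally show ?thesis .
  qed
  have "card Fa * q ^ (n - Suc a) = (\<Sum>A\<in>Fa. q ^ (n - Suc a))" by simp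
  also have "\<dots> \<le> (\<Sum>A\<in>Fa. card {B \<in> S. A \<subseteq> B})" by (intro sum_mono up)
  also have "\<dots> = (\<Sum>B\<in>S. card {A \<in> Fa. A \<subseteq> B})" using fin by (intro sum_card_swap)
  also have "\<dots> \<le> (\<Sum>B\<in>S. q ^ (n - Suc a))" by (intro sum_mono down)
  finally have "card Fa \<le> card S" using q2 by simp
  moreover have "card F = card F1 + card Fa"
  proof -
    have "Fa \<subseteq> F" by (auto simp: Fa_def)
    then show ?thesis using fin card_mono[of F Fa] by (simp add: F1_def card_Diff_subset)
  qed
  moreover have "card (F1 \<union> S) = card F1 + card S"
    using fin by (intro card_Un_disjoint) (auto simp: S_def)
  ultimately have "card F \<le> card (F1 \<union> S)" by simp
  moreover have "F1 \<union> S \<subseteq> L" "\<forall>A\<in>F1 \<union> S. a + 1 \<le> rk A \<and> rk A \<le> c"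
    using F1 c by (auto simp: S_def)
  ultimately show ?thesis using cc by blast
qed

lemma raise_levels:
  assumes F: "F \<subseteq> L" "chain_comps F" and r: "\<And>A. A \<in> F \<Longrightarrow> 1 \<le> rk A \<and> rk A \<le> c"
    and c: "c < n" and b: "1 \<le> b" "b \<le> c" "2 * b \<le> n"
  shows "\<exists>F'\<subseteq>L. chain_comps F' \<and> (\<forall>A\<in>F'. b \<le> rk A \<and> rk A \<le> c) \<and> card F \<le> card F'"
  using b
proof (induction b rule: nat_induct_at_least)
  case base
  then show ?case using F r by blast
next
  case (Suc b)
  then obtain F' where F': "F' \<subseteq> L" "chain_comps F'" "\<forall>A\<in>F'. b \<le> rk A \<and> rk A \<le> c" "card F \<le> card F'"
    by auto
  obtain F'' where "F'' \<subseteq> L" "chain_comps F''" "\<forall>A\<in>F''. b + 1 \<le> rk A \<and> rk A \<le> c" "card F' \<le> card F''"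
    using raise_lowest_level[OF F'(1,2), of b c] F'(3) Suc.prems c by auto
  then show ?case using F'(4) by (intro exI[of _ F'']) auto
qed

text \<open>Raising in the lattice and then in its dual presses the family between the ranks
  \<open>n div 2\<close> and \<open>n - n div 2\<close>: one level for even \<open>n\<close>, two
  adjacent ones for odd \<open>n\<close>.\<close>

lemma chain_comps_bound:
  assumes F: "F \<subseteq> L" "chain_comps F" "bot \<notin> F" "top \<notin> F" and n: "2 \<le> n"
  shows "card F \<le> card (lev bot top (n div 2))"
proof -
  let ?m = "n div 2"
  have "1 \<le> rk A \<and> rk A \<le> n - 1" if "A \<in> F" for A
  proof -
    have "A \<in> L" "bot \<subset> A" "A \<subset> top" using F that bot_le[of A] le_top[of A] by auto
    then show ?thesis using rk_strict[of bot A] rk_strict[of A top] bot_in top_in rk_bot rk_top by auto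
  qed
  then have "\<exists>F1\<subseteq>L. chain_comps F1 \<and> (\<forall>A\<in>F1. ?m \<le> rk A \<and> rk A \<le> n - 1) \<and> card F \<le> card F1"
    using n by (intro raise_levels[OF F(1,2)]) auto
  then obtain F1 where F1: "F1 \<subseteq> L" "chain_comps F1" "\<forall>A\<in>F1. ?m \<le> rk A \<and> rk A \<le> n - 1" "card F \<le> card F1"
    by blast
  \<comment> \<open>The cap \<open>n - ?m\<close> on dual ranks preserves the lower bound on ranks
    gained by the first round.\<close>
  have "\<exists>F'\<subseteq>uminus ` L. chain_comps F' \<and> (\<forall>A\<in>F'. ?m \<le> n - rk (- A) \<and> n - rk (- A) \<le> n - ?m)
      \<and> card (uminus ` F1) \<le> card F'"
  proof (rule q_lattice.raise_levels[OF dual])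
    show "chain_comps (uminus ` F1)" using F1 by (simp add: chain_comps_uminus)
    show "1 \<le> n - rk (- A) \<and> n - rk (- A) \<le> n - ?m" if "A \<in> uminus ` F1" for A
      using that F1(3) n by fastforce
  qed (use F1 n in auto)
  then obtain F2 where F2: "F2 \<subseteq> uminus ` L" "chain_comps F2"
    "\<forall>A\<in>F2. ?m \<le> n - rk (- A) \<and> n - rk (- A) \<le> n - ?m" "card F1 \<le> card F2"
    by (auto simp: card_uminus_image)
  define F3 where "F3 = uminus ` F2"
  have F3: "F3 \<subseteq> L" "chain_comps F3" "card F1 \<le> card F3"
    using F2 by (auto simp: F3_def chain_comps_uminus card_uminus_image)
  have r: "?m \<le> rk A \<and> rk A \<le> n - ?m" if "A \<in> F3" for A
  proof -
    have "- A \<in> F2" "A \<in> L" using that F3 by (auto simp: F3_def)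
    then show ?thesis using F2(3) rk_le[of A] n by fastforce
  qed
  have "card F3 \<le> card (lev bot top ?m)"
  proof (cases "even n")
    case True
    then have "rk A = ?m" if "A \<in> F3" for A using r[OF that] by (auto elim!: evenE)
    then have "F3 \<subseteq> lev bot top ?m" using F3 by (auto simp: lev_bot_top)
    then show ?thesis by (intro card_mono) auto
  next
    case False
    then have n': "n = 2 * ?m + 1" by (metis odd_two_times_div_two_succ)
    show ?thesis
    proof (rule two_level_bound[OF F3(1,2) n'])
      show "1 \<le> ?m" using n by simp
      show "rk A = ?m \<or> rk A = ?m + 1" if "A \<in> F3" for A using r[OF that] n' by linarith
    qed
  qed
  then show ?thesis using F1(4) F3(3) by linarith
qed

end

subsection \<open>The largest families\<close>

text \<open>Sorting the indices by their coefficients, instead of the coefficients, yields a genuine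
  set of levels even when coefficients coincide.\<close>

lemma Sigma_q_levels:
  assumes "k \<le> n + 1"
  shows "\<exists>I\<subseteq>{..n}. card I = k \<and> Sigma_q q n k = (\<Sum>i\<in>I. q_binomial q n i) \<and>
    (\<forall>i\<in>I. \<forall>j\<in>{..n} - I. q_binomial q n j \<le> q_binomial q n i)"
proof -
  let ?f = "q_binomial q n"
  define idx where "idx = rev (sort_key ?f [0..<n + 1])"
  have sm: "sort (map ?f [0..<n + 1]) = map ?f (sort_key ?f [0..<n + 1])"
    by (rule properties_for_sort) simp_all
  have set_idx: "set idx = {..n}" "distinct idx" "length idx = n + 1" by (auto simp: idx_def)
  have sorted: "sorted_wrt (\<lambda>x y. ?f y \<le> ?f x) idx"
    using sorted_sort_key[of ?f "[0..<n + 1]"]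
    unfolding idx_def sorted_wrt_rev by (simp add: sorted_wrt_map del: upt_Suc)
  let ?I = "set (take k idx)"
  have "Sigma_q q n k = sum_list (map ?f (take k idx))"
    unfolding Sigma_q_def sm by (simp add: idx_def rev_map take_map del: upt_Suc)
  also have "\<dots> = (\<Sum>i\<in>?I. ?f i)"
    using set_idx by (intro sum_list_distinct_conv_sum_set) simp
  finally have 1: "Sigma_q q n k = (\<Sum>i\<in>?I. ?f i)" .
  have 2: "card ?I = k" using set_idx assms by (simp add: distinct_card)
  have 3: "?I \<subseteq> {..n}" using set_idx set_take_subset by metis
  have 4: "?f j \<le> ?f i" if "i \<in> ?I" "j \<in> {..n} - ?I" for i j
  proof -
    have "j \<in> set (take k idx @ drop k idx)" using that set_idx by simp
    then have "j \<in> set (drop k idx)" using that by (simp del: append_take_drop_id)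
    moreover have "sorted_wrt (\<lambda>x y. ?f y \<le> ?f x) (take k idx @ drop k idx)" using sorted by simp
    ultimately show ?thesis using that unfolding sorted_wrt_append by blast
  qed
  show ?thesis using 1 2 3 4 by blast
qed

lemma upper_chain_uminus: "upper_chain (uminus ` F) (- A) \<longleftrightarrow> lower_chain F A"
proof -
  have "{B \<in> uminus ` F. - A \<subset> B} = uminus ` {B \<in> F. B \<subset> A}" by auto
  then show ?thesis unfolding upper_chain_def lower_chain_def by (simp add: chain_subset_uminus)
qed

lemma induced_subposet_subset_iff:
  "induced_subposet P (relation_of (\<subseteq>) F) \<longleftrightarrow>
    (\<exists>\<phi>. inj_on \<phi> (Field P) \<and> \<phi> ` Field P \<subseteq> F \<and>
      (\<forall>x\<in>Field P. \<forall>y\<in>Field P. (x, y) \<in> P \<longleftrightarrow> \<phi> x \<subseteq> \<phi> y))"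
proof -
  have Fld: "Field (relation_of (\<subseteq>) F) = F"
    by (auto simp: relation_of_def Field_def)
  show ?thesis
    unfolding induced_subposet_def Fld
    by (intro ex_cong1 conj_cong refl ball_cong) (simp add: relation_of_def image_subset_iff)
qed

section \<open>From LYM inequalities to the sum of the largest levels\<close>

context q_lattice
begin

lemma card_lev_bot_top: "i \<le> n \<Longrightarrow> real (card (lev bot top i)) = q_binomial q n i"
proof -
  assume i: "i \<le> n"
  have "card (lev bot top i) * (gfact q i * gfact q (n - i)) = gfact q n"
    using card_lev[OF bot_in top_in bot_le[OF top_in], of i] i rk_bot rk_top by simp
  then have "real (card (lev bot top i)) * (real (gfact q i) * real (gfact q (n - i))) = real (gfact q n)"
    by (simp flip: of_nat_mult)
  moreover have "real (gfact q i) * real (gfact q (n - i)) > 0" by simp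
  ultimately show ?thesis unfolding q_binomial_eq[OF q2 i] by (simp only: eq_divide_eq) simp
qed

lemma q_binomial_pos: "i \<le> n \<Longrightarrow> q_binomial q n i > 0"
  by (simp add: q_binomial_eq[OF q2])

lemma q_binomial_inner_ge:
  assumes "1 \<le> i" "i < n"
  shows "q_binomial q n i \<ge> real (gnum q n)"
proof -
  obtain a b where ab: "i = Suc a" "n - i = Suc b" "n = Suc (Suc (a + b))"
    using assms by (metis One_nat_def Suc_le_D Suc_diff_Suc add_Suc_right add_Suc le_add_diff_inverse less_imp_le)
  have "real (gfact q i) * real (gfact q (n - i)) * real (gnum q n) \<le> real (gfact q (Suc (a + b))) * real (gnum q n)"
    using gfact_mult_le[of q a b, folded ab(1,2)]
    by (intro mult_right_mono) (simp_all only: of_nat_mult[symmetric] of_nat_le_iff of_nat_0_le_iff)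
  also have "\<dots> = real (gfact q n)" unfolding ab(3) by (simp add: gfact_Suc[of q "Suc (a + b)"])
  finally show ?thesis
    using q_binomial_eq[OF q2, of i n] assms by (simp add: le_divide_eq mult.commute)
qed

text \<open>The slack \<open>d\<close> is worth three members per unit, since each of the levels \<open>1, \<dots>, n - 1\<close>
  has at least three members.\<close>

lemma card_le_Sigma_q:
  assumes F: "F \<subseteq> L" and lym: "(\<Sum>U\<in>F. 1 / q_binomial q n (rk U)) \<le> real k - d"
    and d: "0 \<le> d" and k: "1 \<le> k" "k + 1 \<le> n"
  shows "real (card F) \<le> Sigma_q q n k - 3 * d"
proof -
  let ?N = "q_binomial q n"
  obtain I where I: "I \<subseteq> {..n}" "card I = k" "Sigma_q q n k = (\<Sum>i\<in>I. ?N i)"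
    "\<forall>i\<in>I. \<forall>j\<in>{..n} - I. ?N j \<le> ?N i"
    using Sigma_q_levels[of k n q] k by auto
  have finI: "finite I" "I \<noteq> {}" using I k finite_subset[of I] by auto
  have finF: "finite F" using F finite_L finite_subset by blast
  have n2: "2 \<le> n" using k by simp
  have big: "3 \<le> ?N i" if "1 \<le> i" "i < n" for i
  proof -
    obtain m where "n = Suc m" "1 \<le> m" using n2 by (cases n) auto
    then have "3 \<le> gnum q n" using le_gnum[OF q2, of m] by simp
    then have "3 \<le> real (gnum q n)" by linarith
    then show ?thesis using q_binomial_inner_ge[OF that] by linarith
  qed
  \<comment> \<open>The smallest chosen coefficient separates the chosen levels from the
    others.\<close>
  define c where "c = Min (?N ` I)"
  have "c \<in> ?N ` I" unfolding c_def using finI by (intro Min_in) auto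
  then obtain i0 where i0: "i0 \<in> I" "c = ?N i0" by auto
  have c: "c \<le> ?N i" if "i \<in> I" for i unfolding c_def using finI that by auto
  have c': "?N j \<le> c" if "j \<in> {..n} - I" for j using I(4) i0 that by auto
  \<comment> \<open>If the minimum is attained at level 0 or \<open>n\<close>, then
    \<open>k < n\<close> leaves some inner level unchosen, and its coefficient is at least 3 and at
    most \<open>c\<close>.\<close>
  have c3: "3 \<le> c"
  proof (cases "1 \<le> i0 \<and> i0 < n")
    case True
    then show ?thesis using big i0 by auto
  next
    case False
    have "\<exists>j\<in>{1..<n}. j \<notin> I"
    proof (rule ccontr)
      assume "\<not> (\<exists>j\<in>{1..<n}. j \<notin> I)"
      then have "insert i0 {1..<n} \<subseteq> I" using i0 by auto
      then have "card (insert i0 {1..<n}) \<le> k" using I(2) finI card_mono by metis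
      moreover have "card (insert i0 {1..<n}) = n" using False n2 by (subst card_insert_disjoint) auto
      ultimately show False using k by simp
    qed
    then obtain j where "j \<in> {1..<n}" "j \<notin> I" by blast
    then show ?thesis using big[of j] c'[of j] by auto
  qed
  define x where "x i = real (card {U \<in> F. rk U = i}) / ?N i" for i
  have rkF: "rk ` F \<subseteq> {..n}" using F rk_le by auto
  have x1: "x i \<le> 1" if "i \<le> n" for i
  proof -
    have "card {U \<in> F. rk U = i} \<le> card (lev bot top i)"
      by (rule card_mono[OF finite_lev]) (use F in \<open>auto simp: lev_bot_top\<close>)
    then show ?thesis
      using card_lev_bot_top[OF that] q_binomial_pos[OF that] by (simp add: x_def)
  qed
  have x0: "0 \<le> x i" if "i \<le> n" for i using q_binomial_pos[OF that] by (simp add: x_def)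
  have sumx: "(\<Sum>i\<le>n. x i) \<le> real k - d"
  proof -
    have "(\<Sum>U\<in>F. 1 / ?N (rk U)) = (\<Sum>i\<le>n. \<Sum>U | U \<in> F \<and> rk U = i. 1 / ?N (rk U))"
      by (rule sum.group[OF finF _ rkF, symmetric]) simp
    also have "\<dots> = (\<Sum>i\<le>n. x i)" by (simp add: x_def)
    finally show ?thesis using lym by simp
  qed
  have "real (card F) = (\<Sum>i\<le>n. real (card {U \<in> F. rk U = i}))"
    using sum.group[OF finF _ rkF, of "\<lambda>_. 1::real"] by simp
  also have "\<dots> = (\<Sum>i\<le>n. x i * ?N i)"
    using q_binomial_pos[THEN less_imp_neq] by (intro sum.cong) (auto simp: x_def)
  also have "\<dots> = (\<Sum>i\<in>{..n} - I. x i * ?N i) + (\<Sum>i\<in>I. x i * ?N i)"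
    using I(1) by (intro sum.subset_diff) auto
  \<comment> \<open>Outside the chosen levels a unit of \<open>x\<close> is worth at most
    \<open>c\<close>, and a unit missing in a chosen level loses at least \<open>c\<close>; hence
    only the sum of all \<open>x i\<close> matters.\<close>
  also have "\<dots> \<le> (\<Sum>i\<in>{..n} - I. x i * c) + (\<Sum>i\<in>I. ?N i + (x i - 1) * c)"
  proof (intro add_mono sum_mono)
    fix i assume i: "i \<in> {..n} - I"
    then show "x i * ?N i \<le> x i * c" using c' x0 by (intro mult_left_mono) auto
  next
    fix i assume i: "i \<in> I"
    then have "(1 - x i) * c \<le> (1 - x i) * ?N i" using c x1[of i] I(1) by (intro mult_left_mono) auto
    then show "x i * ?N i \<le> ?N i + (x i - 1) * c" by (simp add: algebra_simps)
  qed
  also have "\<dots> = ((\<Sum>i\<in>{..n} - I. x i) + (\<Sum>i\<in>I. x i)) * c + (\<Sum>i\<in>I. ?N i) - real k * c"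
    using I(2) by (simp add: sum.distrib sum_subtractf algebra_simps flip: sum_distrib_left sum_distrib_right)
  also have "(\<Sum>i\<in>{..n} - I. x i) + (\<Sum>i\<in>I. x i) = (\<Sum>i\<le>n. x i)"
    using I(1) by (intro sum.subset_diff[symmetric]) auto
  also have "(\<Sum>i\<le>n. x i) * c + (\<Sum>i\<in>I. ?N i) - real k * c \<le> (real k - d) * c + (\<Sum>i\<in>I. ?N i) - real k * c"
    using sumx c3 by (simp add: mult_right_mono)
  also have "\<dots> = Sigma_q q n k - d * c" using I(3) by (simp add: algebra_simps)
  also have "\<dots> \<le> Sigma_q q n k - 3 * d" using mult_left_mono[OF c3 d] by simp
  finally show ?thesis .
qed

text \<open>A full level has LYM sum exactly 1, so the general bound applies with
  \<open>k = 1\<close> and no slack.\<close>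

lemma card_lev_le_Sigma_q:
  assumes "i \<le> n" "2 \<le> n"
  shows "real (card (lev bot top i)) \<le> Sigma_q q n 1"
proof -
  have "(\<Sum>U\<in>lev bot top i. 1 / q_binomial q n (rk U)) = real (card (lev bot top i)) * (1 / q_binomial q n i)"
    by (simp add: lev_def)
  also have "\<dots> = 1" using card_lev_bot_top[OF assms(1)] q_binomial_pos[OF assms(1)] by simp
  finally show ?thesis
    using card_le_Sigma_q[of "lev bot top i" 1 0] assms by (auto simp: lev_def)
qed

text \<open>A chain has at most \<open>n + 1\<close> members, which is no more than the size of
  level 1.\<close>

lemma card_chain_le_Sigma_q:
  assumes "F \<subseteq> L" "chain\<^sub>\<subseteq> F" "2 \<le> n"
  shows "real (card F) \<le> Sigma_q q n 1"
proof -
  have "rk ` F \<subseteq> {..n}" using assms rk_le by auto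
  then have "card (rk ` F) \<le> card {..n}" by (intro card_mono) auto
  then have "card F \<le> n + 1" using card_image[OF chain_inj_rk[OF assms(2,1)]] by simp
  also obtain m where m: "n = Suc m" "1 \<le> m" using assms(3) by (cases n) auto
  have "n + 1 \<le> gnum q n" using le_gnum[OF q2, of m] m by simp
  also have "\<dots> = card (lev bot top 1)"
    using card_lev_covers[OF bot_in top_in bot_le[OF top_in], of 1] rk_bot rk_top by simp
  finally have "real (card F) \<le> real (card (lev bot top 1))" by linarith
  then show ?thesis using card_lev_le_Sigma_q[of 1] assms(3) by linarith
qed

text \<open>Adding \<open>bot\<close> turns a chain of \<open>k - 1\<close> members of
  \<open>G\<close> into one of \<open>k\<close> members of \<open>F\<close>, so \<open>G\<close>
  satisfies the condition for \<open>k - 1\<close>. The weak LYM bound leaves a slack of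
  \<open>2 / 3\<close>, worth two members: \<open>bot\<close> and \<open>top\<close>. For
  \<open>k = 1\<close> the family is itself a chain.\<close>

lemma upper_bound_bot:
  assumes F: "F \<subseteq> L" "bot \<in> F" and Y: "Y_free k F" and k: "1 \<le> k" "k + 1 \<le> n"
  shows "real (card F) \<le> Sigma_q q n k"
proof (cases "k = 1")
  case True
  have "upper_chain F bot"
    using Y[unfolded Y_free_def, rule_format, of "{bot}" bot] F True by (simp add: chain_subset_def)
  then have *: "B \<subseteq> C \<or> C \<subseteq> B" if "B \<in> F" "C \<in> F" "bot \<subset> B" "bot \<subset> C" for B C
    using that unfolding upper_chain_def chain_subset_def by simp
  have "chain\<^sub>\<subseteq> F"
    unfolding chain_subset_def
  proof (intro ballI)
    fix B C assume BC: "B \<in> F" "C \<in> F"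
    then have "bot \<subseteq> B" "bot \<subseteq> C" using F bot_le by auto
    then show "B \<subseteq> C \<or> C \<subseteq> B" using *[OF BC] by (cases "B = bot"; cases "C = bot") auto
  qed
  then show ?thesis using card_chain_le_Sigma_q F True k by simp
next
  case False
  define G where "G = F - {bot, top}"
  have finF: "finite F" using F finite_L finite_subset by blast
  have "Y_free (k - 1) G"
    unfolding Y_free_def
  proof (intro allI impI)
    fix S A assume S: "S \<subseteq> G" "chain\<^sub>\<subseteq> S" "card S = k - 1" "A \<in> S" "\<forall>V\<in>S. V \<subseteq> A"
    have le: "bot \<subseteq> V" if "V \<in> S" for V using that S(1) F bot_le by (auto simp: G_def)
    have finS: "finite S" using S(1) finF finite_subset by (auto simp: G_def)
    have "upper_chain F A"
    proof (rule Y[unfolded Y_free_def, rule_format, of "{bot} \<union> S"])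
      show "chain\<^sub>\<subseteq> ({bot} \<union> S)"
        using S(2) le by (intro chain_subset_Un) (auto simp: chain_subset_def)
      have "bot \<notin> S" using S(1) by (auto simp: G_def)
      then show "card ({bot} \<union> S) = k" using S(3) finS False k by simp
      show "V \<subseteq> A" if "V \<in> {bot} \<union> S" for V using that S(4,5) le[of A] by auto
    qed (use S F in \<open>auto simp: G_def\<close>)
    then show "upper_chain G A" unfolding upper_chain_def chain_subset_def by (simp add: G_def)
  qed
  then have "(\<Sum>U\<in>G. 1 / q_binomial q n (rk U)) \<le> real (k - 1) + 1 / 3"
    using F k False by (intro LYM_Y_free_weak) (auto simp: G_def)
  then have "(\<Sum>U\<in>G. 1 / q_binomial q n (rk U)) \<le> real k - 2 / 3" using k by simp
  then have "real (card G) \<le> Sigma_q q n k - 3 * (2 / 3)"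
    using F k by (intro card_le_Sigma_q) (auto simp: G_def)
  moreover have "card F \<le> card G + 2"
  proof -
    have "card F \<le> card (G \<union> {bot, top})" using finF by (intro card_mono) (auto simp: G_def)
    also have "\<dots> \<le> card G + card {bot, top}" by (rule card_Un_le)
    also have "card {bot, top} \<le> 2" by (simp add: card_insert_if)
    finally show ?thesis by simp
  qed
  ultimately show ?thesis by simp
qed

lemma Y_free_uminus: "Y_dual_free k F \<Longrightarrow> Y_free k (uminus ` F)"
  unfolding Y_free_def
proof (intro allI impI)
  fix S A assume Y': "Y_dual_free k F"
    and S: "S \<subseteq> uminus ` F" "chain\<^sub>\<subseteq> S" "card S = k" "A \<in> S" "\<forall>V\<in>S. V \<subseteq> A"
  have "lower_chain F (- A)"
  proof (rule Y'[unfolded Y_dual_free_def, rule_format, of "uminus ` S"])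
    show "chain\<^sub>\<subseteq> (uminus ` S)" "card (uminus ` S) = k"
      using S by (simp_all add: chain_subset_uminus card_uminus_image)
  qed (use S in auto)
  then show "upper_chain (uminus ` F) A" using upper_chain_uminus[of F "- A"] by simp
qed

text \<open>A family containing \<open>top\<close> becomes one containing the bottom of the dual
  lattice. Without either, \<open>k = 1\<close> rests on \<open>chain_comps_bound\<close> and
  \<open>k \<ge> 2\<close> on the LYM inequality.\<close>

lemma card_Y_free_le_Sigma_q:
  assumes F: "F \<subseteq> L" and Y: "Y_free k F" "Y_dual_free k F" and k: "1 \<le> k" "k + 1 \<le> n"
  shows "real (card F) \<le> Sigma_q q n k"
proof -
  consider "bot \<in> F" | "top \<in> F" | "bot \<notin> F" "top \<notin> F" "k = 1" | "bot \<notin> F" "top \<notin> F" "2 \<le> k"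
    using k by linarith
  then show ?thesis
  proof cases
    case 1
    then show ?thesis using upper_bound_bot F Y k by blast
  next
    case 2
    have "real (card (uminus ` F)) \<le> Sigma_q q n k"
      using F 2 k by (intro q_lattice.upper_bound_bot[OF dual _ _ Y_free_uminus[OF Y(2)]]) auto
    then show ?thesis by (simp add: card_uminus_image)
  next
    case 3
    have "chain_comps F"
      unfolding chain_comps_def
    proof
      fix A assume "A \<in> F"
      then show "upper_chain F A \<and> lower_chain F A"
        using Y[unfolded Y_free_def Y_dual_free_def, rule_format, of "{A}" A] 3
        by (simp add: chain_subset_def)
    qed
    then have "card F \<le> card (lev bot top (n div 2))"
      using chain_comps_bound[OF F] 3 k by simp
    then show ?thesis using card_lev_le_Sigma_q[of "n div 2"] 3 k by simp
  next
    case 4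
    then have "(\<Sum>U\<in>F. 1 / q_binomial q n (rk U)) \<le> real k - 0"
      using LYM_Y_free[OF F _ _ Y(1) _ _ Y(2)] by simp
    then show ?thesis using card_le_Sigma_q[OF F, of k 0] k by simp
  qed
qed

end

section \<open>Forbidden induced posets and chains\<close>

lemma induced_Y_poset:
  assumes "finite F" "\<not> induced_subposet (Y_poset k) (relation_of (\<subseteq>) F)"
  shows "Y_free k F"
  unfolding Y_free_def upper_chain_def chain_subset_def[of "{B \<in> F. A \<subset> B}" for A]
proof (intro allI impI ballI)
  fix S A B C
  assume S: "S \<subseteq> F" "chain\<^sub>\<subseteq> S" "card S = k" "A \<in> S" "\<forall>V\<in>S. V \<subseteq> A"
    and BC: "B \<in> {B \<in> F. A \<subset> B}" "C \<in> {B \<in> F. A \<subset> B}"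
  have finS: "finite S" using S assms finite_subset by blast
  show "B \<subseteq> C \<or> C \<subseteq> B"
  proof (rule ccontr)
    assume inc: "\<not> (B \<subseteq> C \<or> C \<subseteq> B)"
    \<comment> \<open>Here \<open>x i\<close> is the \<open>i\<close>-th lowest member of
      \<open>S\<close>; its count makes index order and inclusion agree.\<close>
    have "\<exists>x. \<forall>i\<in>{1..k}. x i \<in> S \<and> card {V \<in> S. V \<subseteq> x i} = i"
    proof (intro bchoice ballI)
      fix i assume "i \<in> {1..k}"
      then show "\<exists>A. A \<in> S \<and> card {V \<in> S. V \<subseteq> A} = i"
        using chain_kth_lowest[OF finS S(2), of i] S(3) by auto
    qed
    then obtain x where "\<forall>i\<in>{1..k}. x i \<in> S \<and> card {V \<in> S. V \<subseteq> x i} = i" by (elim exE)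
    then have x: "x i \<in> S \<and> card {V \<in> S. V \<subseteq> x i} = i" if "1 \<le> i" "i \<le> k" for i
      using that by simp
    have mono: "x i \<subseteq> x j \<longleftrightarrow> i \<le> j" if ij: "1 \<le> i" "i \<le> k" "1 \<le> j" "j \<le> k" for i j
    proof
      assume "x i \<subseteq> x j"
      then have "card {V \<in> S. V \<subseteq> x i} \<le> card {V \<in> S. V \<subseteq> x j}"
        using finS by (intro card_mono) auto
      then show "i \<le> j" using x ij by simp
    next
      assume "i \<le> j"
      show "x i \<subseteq> x j"
      proof (rule ccontr)
        assume n: "\<not> x i \<subseteq> x j"
        then have "x j \<subset> x i" using S(2) x ij unfolding chain_subset_def by blast
        then have "{V \<in> S. V \<subseteq> x j} \<subseteq> {V \<in> S. V \<subseteq> x i}" by auto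
        moreover have "x i \<in> {V \<in> S. V \<subseteq> x i} - {V \<in> S. V \<subseteq> x j}" using x ij n by simp
        ultimately have "{V \<in> S. V \<subseteq> x j} \<subset> {V \<in> S. V \<subseteq> x i}" by blast
        then have "card {V \<in> S. V \<subseteq> x j} < card {V \<in> S. V \<subseteq> x i}"
          using finS by (intro psubset_card_mono) auto
        then show False using x ij \<open>i \<le> j\<close> by simp
      qed
    qed
    have BCF: "B \<in> F" "C \<in> F" "\<not> B \<subseteq> C" "\<not> C \<subseteq> B" using BC inc by auto
    have lt: "x i \<in> F" "x i \<subset> B" "x i \<subset> C" if "1 \<le> i" "i \<le> k" for i
    proof -
      have "x i \<subseteq> A" "x i \<in> F" using x[OF that] S(1,5) by auto
      then show "x i \<in> F" "x i \<subset> B" "x i \<subset> C" using BC by auto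
    qed
    then have lt': "x i \<subseteq> B" "x i \<subseteq> C" "\<not> B \<subseteq> x i" "\<not> C \<subseteq> x i" if "1 \<le> i" "i \<le> k" for i
      using that by (meson psubset_eq subset_not_subset_eq)+
    define \<phi> where "\<phi> v = (case v of x_elt i \<Rightarrow> x i | y_elt \<Rightarrow> B | z_elt \<Rightarrow> C)" for v
    have iff: "(u, v) \<in> Y_poset k \<longleftrightarrow> \<phi> u \<subseteq> \<phi> v"
      if "u \<in> Field (Y_poset k)" "v \<in> Field (Y_poset k)" for u v
      using that[unfolded Field_Y_poset] lt' mono BCF
      by (cases u; cases v) (simp_all add: Y_poset_def \<phi>_def image_iff)
    have "inj_on \<phi> (Field (Y_poset k))"
    proof (rule inj_onI)
      fix u v assume uv: "u \<in> Field (Y_poset k)" "v \<in> Field (Y_poset k)" "\<phi> u = \<phi> v"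
      \<comment> \<open>Equal images include each other, so injectivity comes from antisymmetry of
        \<open>Y_poset\<close>.\<close>
      then have "(u, v) \<in> Y_poset k" "(v, u) \<in> Y_poset k"
        using iff[OF uv(1,2)] iff[OF uv(2,1)] by simp_all
      then show "u = v"
        using Partial_order_Y_poset[of k] unfolding partial_order_on_def by (metis antisymD)
    qed
    moreover have "\<phi> ` Field (Y_poset k) \<subseteq> F"
      using lt(1) BCF by (auto simp: Field_Y_poset \<phi>_def)
    ultimately have "induced_subposet (Y_poset k) (relation_of (\<subseteq>) F)"
      using iff unfolding induced_subposet_subset_iff by (intro exI[of _ \<phi>]) simp
    then show False using assms by simp
  qed
qed

lemma induced_subposet_uminus:
  assumes "induced_subposet P (relation_of (\<subseteq>) (uminus ` F))"
  shows "induced_subposet (P\<inverse>) (relation_of (\<subseteq>) F)"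
proof -
  obtain \<phi> where \<phi>: "inj_on \<phi> (Field P)" "\<phi> ` Field P \<subseteq> uminus ` F"
    "\<forall>x\<in>Field P. \<forall>y\<in>Field P. (x, y) \<in> P \<longleftrightarrow> \<phi> x \<subseteq> \<phi> y"
    using assms unfolding induced_subposet_subset_iff by (elim exE conjE)
  show ?thesis
    unfolding induced_subposet_subset_iff Field_converse
  proof (intro exI[of _ "\<lambda>v. - \<phi> v"] conjI ballI)
    show "inj_on (\<lambda>v. - \<phi> v) (Field P)" using \<phi>(1) by (simp add: inj_on_def)
    show "(\<lambda>v. - \<phi> v) ` Field P \<subseteq> F" using \<phi>(2) by auto
    show "(x, y) \<in> P\<inverse> \<longleftrightarrow> - \<phi> x \<subseteq> - \<phi> y" if "x \<in> Field P" "y \<in> Field P" for x y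
      using \<phi>(3) that by simp
  qed
qed

lemma induced_Y_dual_poset:
  assumes "finite F" "\<not> induced_subposet (Y_dual_poset k) (relation_of (\<subseteq>) F)"
  shows "Y_dual_free k F"
proof -
  have "Y_free k (uminus ` F)"
    using assms induced_subposet_uminus[of "Y_poset k" F]
    by (intro induced_Y_poset) (auto simp: Y_dual_poset_def)
  then show ?thesis
    unfolding Y_dual_free_def
  proof (intro allI impI)
    fix S A assume Y: "Y_free k (uminus ` F)"
      and S: "S \<subseteq> F" "chain\<^sub>\<subseteq> S" "card S = k" "A \<in> S" "\<forall>V\<in>S. A \<subseteq> V"
    have "upper_chain (uminus ` F) (- A)"
    proof (rule Y[unfolded Y_free_def, rule_format, of "uminus ` S"])
      show "chain\<^sub>\<subseteq> (uminus ` S)" "card (uminus ` S) = k"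
        using S by (simp_all add: chain_subset_uminus card_uminus_image)
    qed (use S in auto)
    then show "lower_chain F A" by (simp add: upper_chain_uminus)
  qed
qed

section \<open>Families attaining the bound\<close>

text \<open>An embedding sends the pairwise comparable elements of \<open>T\<close> to elements of
  distinct ranks in \<open>I\<close>, but there is one element too many.\<close>

lemma (in q_lattice) not_induced_of_levels:
  assumes P: "T \<subseteq> Field P" "card T = Suc (card I)" "\<And>u v. u \<in> T \<Longrightarrow> v \<in> T \<Longrightarrow> (u, v) \<in> P \<or> (v, u) \<in> P"
    and I: "finite I"
  shows "\<not> induced_subposet P (relation_of (\<subseteq>) {W \<in> L. rk W \<in> I})"
proof
  assume "induced_subposet P (relation_of (\<subseteq>) {W \<in> L. rk W \<in> I})"
  then obtain \<phi> where \<phi>: "inj_on \<phi> (Field P)" "\<phi> ` Field P \<subseteq> {W \<in> L. rk W \<in> I}"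
    "\<forall>x\<in>Field P. \<forall>y\<in>Field P. (x, y) \<in> P \<longleftrightarrow> \<phi> x \<subseteq> \<phi> y"
    unfolding induced_subposet_subset_iff by (elim exE conjE)
  have in_I: "\<phi> u \<in> L" "rk (\<phi> u) \<in> I" if "u \<in> T" for u
    using \<phi>(2) P(1) that by auto
  have "inj_on (\<lambda>u. rk (\<phi> u)) T"
  proof (rule inj_onI)
    fix u v assume uv: "u \<in> T" "v \<in> T" "rk (\<phi> u) = rk (\<phi> v)"
    then have "\<phi> u \<subseteq> \<phi> v \<or> \<phi> v \<subseteq> \<phi> u"
      using P(1) P(3)[OF uv(1,2)] \<phi>(3) by (metis subsetD)
    then have "\<phi> u = \<phi> v"
      using rk_eqD[of "\<phi> u" "\<phi> v"] rk_eqD[of "\<phi> v" "\<phi> u"] in_I uv by auto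
    then show "u = v" using \<phi>(1) P(1) uv by (auto dest: inj_onD)
  qed
  moreover have "(\<lambda>u. rk (\<phi> u)) ` T \<subseteq> I" using in_I by auto
  ultimately have "card T \<le> card I" using I card_inj_on_le by blast
  then show False using P(2) by simp
qed

text \<open>The union of the levels given by \<open>Sigma_q_levels\<close> attains the upper bound.
  The maximum is written out to match the unfolded \<open>La_star\<close>.\<close>

lemma (in q_lattice) Max_Y_free_eq_Sigma_q:
  assumes k: "1 \<le> k" "k + 1 \<le> n"
  shows "real (Max {card F |F. F \<subseteq> L \<and> (\<forall>P\<in>{Y_poset k, Y_dual_poset k}. \<not> induced_subposet P (relation_of (\<subseteq>) F))})
    = Sigma_q q n k"
proof -
  obtain I where I: "I \<subseteq> {..n}" "card I = k" "Sigma_q q n k = (\<Sum>i\<in>I. q_binomial q n i)"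
    using Sigma_q_levels[of k n q] k by auto
  have finI: "finite I" using I finite_subset by blast
  let ?G = "{W \<in> L. rk W \<in> I}"
  have cG: "real (card ?G) = Sigma_q q n k"
  proof -
    have "card ?G = (\<Sum>i\<in>I. card {W \<in> ?G. rk W = i})"
      using finI finite_L sum.group[of ?G I rk "\<lambda>_. 1::nat"] by (simp add: image_subset_iff)
    also have "\<dots> = (\<Sum>i\<in>I. card (lev bot top i))"
      by (intro sum.cong) (auto simp: lev_bot_top intro!: arg_cong[of _ _ card])
    finally show ?thesis using I card_lev_bot_top by (auto simp: subset_eq intro!: sum.cong)
  qed
  \<comment> \<open>The chain \<open>x_1 < ... < x_k < y\<close> has one element more than there are
    levels, and it serves for both posets.\<close>
  let ?T = "x_elt ` {1..k} \<union> {y_elt}"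
  have cT: "card ?T = Suc (card I)"
  proof -
    have "card (x_elt ` {1..k}) = k" by (simp add: card_image inj_on_def)
    then show ?thesis using I by (subst card_Un_disjoint) auto
  qed
  have comp: "(u, v) \<in> Y_poset k \<or> (v, u) \<in> Y_poset k" if "u \<in> ?T" "v \<in> ?T" for u v
    using that by (auto simp: Y_poset_def)
  have "\<not> induced_subposet (Y_poset k) (relation_of (\<subseteq>) ?G)"
    by (rule not_induced_of_levels[OF _ cT comp finI]) (auto simp: Field_Y_poset)
  moreover have "\<not> induced_subposet (Y_dual_poset k) (relation_of (\<subseteq>) ?G)"
    unfolding Y_dual_poset_def
    by (rule not_induced_of_levels[OF _ cT _ finI]) (use comp in \<open>auto simp: Field_Y_poset\<close>)
  moreover have "card F \<le> card ?G"
    if "F \<subseteq> L" "\<forall>P\<in>{Y_poset k, Y_dual_poset k}. \<not> induced_subposet P (relation_of (\<subseteq>) F)" for F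
  proof -
    have "finite F" using that finite_L finite_subset by blast
    then have "real (card F) \<le> Sigma_q q n k"
      using that k by (intro card_Y_free_le_Sigma_q induced_Y_poset induced_Y_dual_poset) auto
    then show ?thesis using cG by linarith
  qed
  moreover have "finite {card F |F. F \<subseteq> L \<and> (\<forall>P\<in>{Y_poset k, Y_dual_poset k}. \<not> induced_subposet P (relation_of (\<subseteq>) F))}"
    using finite_L by simp
  ultimately have "Max {card F |F. F \<subseteq> L \<and> (\<forall>P\<in>{Y_poset k, Y_dual_poset k}. \<not> induced_subposet P (relation_of (\<subseteq>) F))}
      = card ?G"
    by (intro Max_eqI) auto
  then show ?thesis using cG by simp
qed

section \<open>The lattice of subspaces\<close>

text \<open>Vectors of the larger span are \<open>scale c a + s\<close> with unique \<open>c\<close>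
  and \<open>s\<close>, since two different values of \<open>c\<close> would put \<open>a\<close>
  into \<open>span S\<close>.\<close>

lemma card_span_insert:
  fixes scale :: "'f::{field,finite} \<Rightarrow> 'v::ab_group_add \<Rightarrow> 'v"
  assumes "vector_space scale" "a \<notin> module.span scale S"
  shows "card (module.span scale (insert a S)) = CARD('f) * card (module.span scale S)"
proof -
  interpret vector_space scale by fact
  let ?g = "\<lambda>(c, s). scale c a + s"
  have "span (insert a S) = ?g ` (UNIV \<times> span S)"
  proof (intro equalityI subsetI)
    fix x assume "x \<in> span (insert a S)"
    then obtain c where "x - scale c a \<in> span S" by (auto simp: span_breakdown_eq)
    then show "x \<in> ?g ` (UNIV \<times> span S)"
      by (intro image_eqI[of _ _ "(c, x - scale c a)"]) auto
  next
    fix x assume "x \<in> ?g ` (UNIV \<times> span S)"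
    then obtain c s where "x = scale c a + s" "s \<in> span S" by auto
    then show "x \<in> span (insert a S)" unfolding span_breakdown_eq by (intro exI[of _ c]) simp
  qed
  moreover have "inj_on ?g (UNIV \<times> span S)"
  proof (rule inj_onI, clarify)
    fix c s c' s' assume *: "s \<in> span S" "s' \<in> span S" "scale c a + s = scale c' a + s'"
    have "c = c'"
    proof (rule ccontr)
      assume ne: "c \<noteq> c'"
      have "scale (c - c') a = s' - s" using *(3) by (simp add: scale_left_diff_distrib algebra_simps)
      then have "scale (c - c') a \<in> span S" using * by (simp add: span_diff)
      then have "scale (inverse (c - c')) (scale (c - c') a) \<in> span S" by (rule span_scale)
      then show False using assms(2) ne by simp
    qed
    then show "c = c' \<and> s = s'" using * by simp
  qed
  ultimately show ?thesis by (simp add: card_image card_cartesian_product)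
qed

lemma card_span_independent:
  fixes scale :: "'f::{field,finite} \<Rightarrow> 'v::ab_group_add \<Rightarrow> 'v"
  assumes "vector_space scale" "finite S" "\<not> module.dependent scale S"
  shows "card (module.span scale S) = CARD('f) ^ card S"
  using assms(2,3)
proof (induction S)
  case empty
  interpret vector_space scale by fact
  show ?case by simp
next
  case (insert a S)
  interpret vector_space scale by fact
  have "a \<notin> span S" "independent S" using insert by (auto simp: independent_insert)
  then show ?case using insert card_span_insert[OF assms(1), of a S] by simp
qed

text \<open>Dimensions are compared through cardinalities, as a subspace has
  \<open>CARD('f) ^ dim\<close> elements. For \<open>covers\<close>, the sets \<open>W - A\<close>
  over the covers \<open>W\<close> of \<open>A\<close> inside \<open>B\<close> partition
  \<open>B - A\<close> into parts of equal size.\<close>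

lemma q_lattice_subspaces:
  fixes scale :: "'f::{field,finite} \<Rightarrow> 'v::ab_group_add \<Rightarrow> 'v"
  assumes vs: "vector_space scale" and n: "vector_space.dim scale (UNIV :: 'v set) = n" "n > 0"
  shows "q_lattice {W. module.subspace scale W} (vector_space.dim scale) {0} UNIV CARD('f) n"
proof -
  interpret vector_space scale by fact
  let ?q = "CARD('f)"
  have q2: "2 \<le> ?q"
  proof -
    have "card {0, 1 :: 'f} \<le> ?q" by (intro card_mono) auto
    then show ?thesis by simp
  qed
  obtain B0 where B0: "independent B0" "UNIV \<subseteq> span B0" "card B0 = n"
    using basis_exists[of UNIV] n(1) by metis
  \<comment> \<open>Infinite sets have \<open>card\<close> 0, so \<open>n > 0\<close> makes the
    basis finite.\<close>
  have "finite B0" using B0(3) n(2) card_gt_0_iff by metis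
  then have "card (UNIV :: 'v set) = ?q ^ n"
    using card_span_independent[OF vs _ B0(1)] \<open>finite B0\<close> B0(3) top.extremum_uniqueI[OF B0(2)] by simp
  then have "card (UNIV :: 'v set) > 0" using q2 by simp
  then have fin: "finite (UNIV :: 'v set)" by (rule card_ge_0_finite)
  then have finS: "finite S" for S :: "'v set" by (rule finite_subset[OF subset_UNIV])
  have finSS: "finite \<A>" for \<A> :: "'v set set"
    using fin by (intro finite_subset[OF _ finite_Pow_iff[THEN iffD2, OF fin]]) simp
  have card_sub: "card W = ?q ^ dim W" if "subspace W" for W
  proof -
    obtain B where B: "B \<subseteq> W" "independent B" "W \<subseteq> span B" "card B = dim W"
      using basis_exists[of W] by metis
    have "span B = W" using span_minimal[OF B(1) that] B(3) by (rule subset_antisym)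
    then show ?thesis using card_span_independent[OF vs finS B(2)] B(4) by simp
  qed
  have dim_less: "dim A < dim B" if "subspace A" "subspace B" "A \<subset> B" for A B
  proof -
    have "card A < card B" using that finS by (intro psubset_card_mono)
    then show ?thesis using card_sub that q2 by (simp add: power_strict_increasing_iff)
  qed
  have dim_span_insert: "dim (span (insert v A)) = Suc (dim A)" if "subspace A" "v \<notin> A" for v A
  proof -
    have "span A = A" using that(1) by (simp add: span_eq_iff)
    then have "card (span (insert v A)) = ?q * card A"
      using card_span_insert[OF vs, of v A] that(2) by metis
    then have "?q ^ dim (span (insert v A)) = ?q ^ Suc (dim A)"
      unfolding card_sub[OF that(1)] card_sub[OF subspace_span] by simp
    then show ?thesis using q2 by (subst (asm) power_inject_exp) simp_all
  qed
  have geom: "gnum ?q d * (?q - 1) + 1 = ?q ^ d" for d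
  proof (induction d)
    case (Suc d)
    have "gnum ?q (Suc d) * (?q - 1) + 1 = ?q ^ d * (?q - 1) + (gnum ?q d * (?q - 1) + 1)"
      by (simp add: gnum_Suc algebra_simps)
    also have "\<dots> = ?q ^ d * (?q - 1 + 1)" unfolding Suc by (simp add: algebra_simps)
    also have "\<dots> = ?q ^ Suc d" using q2 by simp
    finally show ?case .
  qed simp
  show ?thesis
  proof
    show "2 \<le> ?q" by (rule q2)
    show "finite {W. subspace W}" by (rule finSS)
    show "{0} \<in> {W. subspace W}" "UNIV \<in> {W. subspace W}" "dim UNIV = n"
      using n by (auto simp: subspace_single_0 subspace_UNIV)
    show "dim {0} = 0" using card_sub[OF subspace_single_0] q2 by (cases "dim {0}") auto
    show "{0} \<subseteq> A" "A \<subseteq> UNIV" if "A \<in> {W. subspace W}" for A using that subspace_0 by auto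
    show "dim A < dim B" if "A \<in> {W. subspace W}" "B \<in> {W. subspace W}" "A \<subset> B" for A B
      using dim_less that by simp
  next
    fix A B assume "A \<in> {W. subspace W}" "B \<in> {W. subspace W}" and AB: "A \<subseteq> B"
    then have sub: "subspace A" "subspace B" by auto
    let ?C = "{W \<in> {W. subspace W}. A \<subseteq> W \<and> W \<subseteq> B \<and> dim W = Suc (dim A)}"
    \<comment> \<open>Any vector of \<open>W\<close> outside \<open>A\<close> determines
      \<open>W\<close>, which makes the parts disjoint.\<close>
    have W_eq: "W = span (insert v A)" if "W \<in> ?C" "v \<in> W - A" for v W
    proof -
      have "span (insert v A) \<subseteq> W" using that by (intro span_minimal) auto
      moreover have "card W \<le> card (span (insert v A))"
        using card_sub that dim_span_insert[OF sub(1), of v] by simp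
      ultimately show ?thesis using card_seteq finS by metis
    qed
    have "B - A = (\<Union>W\<in>?C. W - A)"
    proof (intro equalityI subsetI)
      fix v assume v: "v \<in> B - A"
      have "span (insert v A) \<in> ?C"
        using v sub AB dim_span_insert[OF sub(1), of v] span_superset[of "insert v A"]
          span_minimal[of "insert v A" B] by auto
      moreover have "v \<in> span (insert v A)" by (simp add: span_base)
      ultimately show "v \<in> (\<Union>W\<in>?C. W - A)" using v by blast
    qed auto
    then have "card (B - A) = card (\<Union>W\<in>?C. W - A)" by simp
    also have "\<dots> = (\<Sum>W\<in>?C. card (W - A))"
    proof (rule card_UN_disjoint)
      show "finite ?C" by (rule finSS)
      show "\<forall>W\<in>?C. finite (W - A)" using finS by simp
      show "\<forall>W\<in>?C. \<forall>W'\<in>?C. W \<noteq> W' \<longrightarrow> (W - A) \<inter> (W' - A) = {}"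
      proof (intro ballI impI equals0I)
        fix W W' v assume "W \<in> ?C" "W' \<in> ?C" "W \<noteq> W'" "v \<in> (W - A) \<inter> (W' - A)"
        then show False using W_eq[of W v] W_eq[of W' v] by simp
      qed
    qed
    also have "\<dots> = (\<Sum>W\<in>?C. ?q ^ dim A * (?q - 1))"
    proof (rule sum.cong)
      fix W assume W: "W \<in> ?C"
      then have "card (W - A) = card W - card A" using finS by (intro card_Diff_subset) auto
      then show "card (W - A) = ?q ^ dim A * (?q - 1)"
        using W card_sub sub by (simp add: algebra_simps diff_mult_distrib2)
    qed simp
    finally have 1: "card (B - A) = card ?C * (?q ^ dim A * (?q - 1))" by simp
    have le: "dim A \<le> dim B" using dim_less[OF sub] AB by (cases "A = B") (auto simp: psubset_eq)
    have "card (B - A) = card B - card A" using finS AB by (intro card_Diff_subset) auto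
    also have "\<dots> = ?q ^ dim A * (?q ^ (dim B - dim A) - 1)"
      using card_sub sub le by (simp add: diff_mult_distrib2 flip: power_add)
    also have "\<dots> = gnum ?q (dim B - dim A) * (?q ^ dim A * (?q - 1))"
      unfolding geom[of "dim B - dim A", symmetric] by simp
    finally show "card ?C = gnum ?q (dim B - dim A)" using 1 q2 by simp
  next
    fix A A' W W'
    assume *: "A \<in> {W. subspace W}" "A' \<in> {W. subspace W}" "W \<in> {W. subspace W}" "W' \<in> {W. subspace W}"
      "A \<noteq> A'" "dim A' = dim A" "dim W = Suc (dim A)" "dim W' = Suc (dim A)"
      "A \<subseteq> W" "A \<subseteq> W'" "A' \<subseteq> W" "A' \<subseteq> W'"
    show "W = W'"
    proof (rule ccontr)
      assume "W \<noteq> W'"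
      \<comment> \<open>The intersection contains two different subspaces of dimension
        \<open>dim A\<close>, so its dimension is larger; yet it is a proper subspace of
        \<open>W\<close> or of \<open>W'\<close>.\<close>
      have s: "subspace (W \<inter> W')" using * by (auto intro: subspace_inter)
      have "W \<inter> W' \<noteq> W \<or> W \<inter> W' \<noteq> W'" using \<open>W \<noteq> W'\<close> by auto
      then have "W \<inter> W' \<subset> W \<or> W \<inter> W' \<subset> W'" by blast
      then have "dim (W \<inter> W') < Suc (dim A)"
        using dim_less[OF s, of W] dim_less[OF s, of W'] * by auto
      moreover have "W \<inter> W' \<noteq> A \<or> W \<inter> W' \<noteq> A'" using *(5) by auto
      then have "A \<subset> W \<inter> W' \<or> A' \<subset> W \<inter> W'" using * by blast
      then have "dim A < dim (W \<inter> W')"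
        using dim_less[OF _ s, of A] dim_less[OF _ s, of A'] * by auto
      ultimately show False by simp
    qed
  qed
qed

theorem theorem15:
  fixes scale :: "'f::{field,finite} \<Rightarrow> 'v::ab_group_add \<Rightarrow> 'v"
    and q n k :: nat
  assumes "primepow q"
    and "CARD('f) = q"
    and "vector_space scale"
    and "vector_space.dim scale (UNIV :: 'v set) = n"
    and "k \<ge> 1"
    and "n \<ge> k + 1"
  shows "real (La_star scale {Y_poset k, Y_dual_poset k}) = Sigma_q q n k"
proof -
  interpret q_lattice "{W. module.subspace scale W}" "vector_space.dim scale" "{0}" UNIV q n
    using q_lattice_subspaces[OF assms(3,4)] assms by simp
  show ?thesis
    unfolding La_star_def by (rule Max_Y_free_eq_Sigma_q) (use assms in auto)
qed

end
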